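(* Let $d\geq 3$. The only Gutkin billiard tables in $\mathbf{R}^d$ are round spheres. That is: let $S\subset\mathbf{R}^d$ be a smooth hypersurface bounding a compact convex domain, with all principal curvatures positive everywhere, and suppose there exists $\delta\in(0,\pi/2)$ such that for every pair of distinct points $p,q\in S$ the following holds: if the angle between the vector $\overrightarrow{pq}$ and the tangent hyperplane to $S$ at $p$ equals $\delta$, then the angle between $\overrightarrow{pq}$ and the tangent hyperplane to $S$ at $q$ also equals $\delta$. Then $S$ is a round sphere.
   Context: A Gutkin billiard table in $\mathbf{R}^d$ is a smooth hypersurface $S$ bounding a compact convex domain (with non-empty interior) in Euclidean space $\mathbf{R}^d$, with positive principal curvatures everywhere (with respect to the inner normal), for which there exists $\delta\in(0,\pi/2)$ with the equal-angle property described in the statement. The angle between a nonzero vector and a hyperplane is the unsigned angle in $[0,\pi/2]$. Smooth means $C^\infty$. *)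

theory Defs
  imports "HOL-Analysis.Analysis"
begin

primrec Ck_on :: "nat \<Rightarrow> ('a::euclidean_space \<Rightarrow> 'b::real_normed_vector) \<Rightarrow> 'a set \<Rightarrow> bool" where
  "Ck_on 0 f U \<longleftrightarrow> continuous_on U f"
| "Ck_on (Suc k) f U \<longleftrightarrow>
     (\<forall>x\<in>U. f differentiable (at x)) \<and> (\<forall>v. Ck_on k (\<lambda>x. frechet_derivative f (at x) v) U)"

text \<open>Only used for open \<open>U\<close>.\<close>

definition smooth_on :: "('a::euclidean_space \<Rightarrow> 'b::real_normed_vector) \<Rightarrow> 'a set \<Rightarrow> bool" where
  "smooth_on f U \<longleftrightarrow> (\<forall>k. Ck_on k f U)"

definition local_defining_function ::
    "'a::euclidean_space set \<Rightarrow> 'a \<Rightarrow> 'a set \<Rightarrow> ('a \<Rightarrow> real) \<Rightarrow> bool" where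
  "local_defining_function S p U f \<longleftrightarrow>
     open U \<and> p \<in> U \<and> smooth_on f U \<and> S \<inter> U = {x \<in> U. f x = 0} \<and>
     (\<forall>x \<in> S \<inter> U. \<exists>v. frechet_derivative f (at x) v \<noteq> 0)"

definition smooth_hypersurface :: "'a::euclidean_space set \<Rightarrow> bool" where
  "smooth_hypersurface S \<longleftrightarrow> (\<forall>p\<in>S. \<exists>U f. local_defining_function S p U f)"

text \<open>The direction space of the tangent hyperplane at \<open>p\<close>, i.e. the kernel of the differential of
  a local defining function; for \<open>p \<in> S\<close> this kernel does not depend on the chosen function.\<close>

definition tangent_space :: "'a::euclidean_space set \<Rightarrow> 'a \<Rightarrow> 'a set" where
  "tangent_space S p =
     {v. \<exists>U f. local_defining_function S p U f \<and> frechet_derivative f (at p) v = 0}"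

text \<open>The unsigned angle in \<open>[0, \<pi>/2]\<close> between a nonzero vector \<open>v\<close> and the hyperplane with direction
  space \<open>H\<close>: its sine is the distance from the endpoint of \<open>v\<close> to \<open>H\<close> divided by the length of \<open>v\<close>.\<close>

definition hyperplane_angle :: "'a::euclidean_space \<Rightarrow> 'a set \<Rightarrow> real" where
  "hyperplane_angle v H = arcsin (infdist v H / norm v)"

text \<open>\<open>K\<close> is the body bounded by the hypersurface \<open>frontier K\<close>.\<close>

definition inner_unit_normal :: "'a::euclidean_space set \<Rightarrow> 'a \<Rightarrow> 'a" where
  "inner_unit_normal K p =
     (THE n. norm n = 1 \<and> (\<forall>v \<in> tangent_space (frontier K) p. n \<bullet> v = 0) \<and>
             (\<exists>\<epsilon>>0. \<forall>t\<in>{0<..<\<epsilon>}. p + t *\<^sub>R n \<in> interior K))"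

text \<open>The normal field lives on the hypersurface only, so it is differentiated within
  \<open>frontier K\<close>. A derivative within this set is uniquely determined exactly on tangent vectors, so
  \<open>shape_operator K p v\<close> is meaningful only for \<open>v\<close> in the tangent space at \<open>p\<close>. The sign makes the
  principal curvatures of a ball of radius \<open>r\<close> equal to \<open>1/r\<close>.\<close>

definition shape_operator :: "'a::euclidean_space set \<Rightarrow> 'a \<Rightarrow> 'a \<Rightarrow> 'a" where
  "shape_operator K p v = - frechet_derivative (inner_unit_normal K) (at p within frontier K) v"

definition principal_curvature :: "'a::euclidean_space set \<Rightarrow> 'a \<Rightarrow> real \<Rightarrow> bool" where
  "principal_curvature K p \<kappa> \<longleftrightarrow>
     (\<exists>v \<in> tangent_space (frontier K) p. v \<noteq> 0 \<and> shape_operator K p v = \<kappa> *\<^sub>R v)"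

end

theory Submission
  imports Defs
begin

text \<open>Write \<open>n\<close> for the inner unit normal, \<open>D\<close> for its derivative, and for a unit tangent vector \<open>v\<close>
  at \<open>p\<close> let \<open>L(p,v)\<close> be the length of the chord leaving \<open>p\<close> in the direction
  \<open>w = cos \<delta> v + sin \<delta> n\<close>; at its end \<open>q\<close> the equal-angle property gives
  \<open>w = cos \<delta> u - sin \<delta> n\<close> with a unit tangent vector \<open>u\<close>. The map \<open>(p,v) \<mapsto> (q,u)\<close> is
  symplectic, so it carries the geodesic spray to \<open>\<mu>\<close> times the geodesic spray, where
  \<open>(\<mu> sin \<delta>)\<^sup>2\<close> is an explicit quadratic polynomial in \<open>L\<close> whose coefficients depend on \<open>v \<bullet> D v\<close>
  and \<open>D v \<bullet> D v\<close>. Turning \<open>v\<close> in the tangent space changes \<open>L\<close> at a rate determined by \<open>L\<close>, \<open>\<mu>\<close>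
  and \<open>D\<close>. In dimension at least 3 the directions \<open>v\<close> and \<open>-v\<close> lie on a circle, and uniqueness for
  this differential equation yields \<open>L(p,v) = L(p,-v)\<close>. Differentiating along a geodesic gives
  \<open>\<mu>(p,v) + \<mu>(p,-v) = 2\<close>, while \<open>\<mu>\<^sup>2\<close> is even in \<open>v\<close>; hence \<open>\<mu> = 1\<close>. The algebraic and the
  differential relation are then compatible only if \<open>D v\<close> is a multiple of \<open>v\<close>: every point is
  umbilic, \<open>L\<close> is constant, and \<open>p + L / (2 sin \<delta>) n\<close> is a fixed centre.\<close>

section \<open>Convex bodies with a differentiable unit normal\<close>

lemma has_real_derivative_inner:
  fixes f g :: "real \<Rightarrow> 'a::real_inner"
  assumes "(f has_vector_derivative f') (at t)" and "(g has_vector_derivative g') (at t)"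
  shows "((\<lambda>x. f x \<bullet> g x) has_real_derivative (f t \<bullet> g' + f' \<bullet> g t)) (at t)"
  using bounded_bilinear.has_vector_derivative[OF bounded_bilinear_inner assms]
  by (simp add: has_real_derivative_iff_has_vector_derivative)

lemma has_vector_derivative_at_iff_difference_quotient:
  fixes f :: "real \<Rightarrow> 'a::real_normed_vector"
  shows "(f has_vector_derivative f') (at t) \<longleftrightarrow> ((\<lambda>s. (f s - f t) /\<^sub>R (s - t)) \<longlongrightarrow> f') (at t)"
proof -
  have "(f has_vector_derivative f') (at t) \<longleftrightarrow>
      ((\<lambda>s. ((f s - f t) - (s - t) *\<^sub>R f') /\<^sub>R norm (s - t)) \<longlongrightarrow> 0) (at t)"
    by (simp add: has_vector_derivative_def has_derivative_at_within bounded_linear_scaleR_left diff_diff_eq)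
  also have "\<dots> \<longleftrightarrow> ((\<lambda>s. (f s - f t) /\<^sub>R (s - t) - f') \<longlongrightarrow> 0) (at t)"
  proof -
    have "norm (((f s - f t) - (s - t) *\<^sub>R f') /\<^sub>R norm (s - t)) = norm ((f s - f t) /\<^sub>R (s - t) - f')"
      if "s \<noteq> t" for s
    proof -
      have "(f s - f t) /\<^sub>R (s - t) - f' = ((f s - f t) - (s - t) *\<^sub>R f') /\<^sub>R (s - t)"
        using that by (simp add: scaleR_diff_right)
      then show ?thesis by simp
    qed
    then have "\<forall>\<^sub>F s in at t. norm (((f s - f t) - (s - t) *\<^sub>R f') /\<^sub>R norm (s - t))
        = norm ((f s - f t) /\<^sub>R (s - t) - f')"
      by (simp add: eventually_at_filter)
    from tendsto_cong[OF this, of 0] show ?thesis by (simp only: tendsto_norm_zero_iff)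
  qed
  also have "\<dots> \<longleftrightarrow> ((\<lambda>s. (f s - f t) /\<^sub>R (s - t)) \<longlongrightarrow> f') (at t)"
    by (rule LIM_zero_iff)
  finally show ?thesis .
qed

text \<open>Gronwall: with \<open>C\<close> bounding \<open>\<bar>g\<bar>\<close> between
  \<open>t\<close> and \<open>t0\<close>, the weight \<open>exp (\<sigma> * 2 * C * s)\<close> makes
  the weighted square of \<open>d\<close> monotone, so that its value at \<open>t\<close> is at most
  its value 0 at \<open>t0\<close>. The sign \<open>\<sigma> = 1\<close> serves the left of
  \<open>t0\<close>, \<open>\<sigma> = -1\<close> the right.\<close>

lemma linear_ode_eq_zero:
  fixes d g :: "real \<Rightarrow> real"
  assumes d: "\<And>t. (d has_real_derivative g t * d t) (at t)" and g: "continuous_on UNIV g"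
    and "d t0 = 0"
  shows "d t = 0"
proof -
  let ?a = "min t t0" and ?b = "max t t0"
  obtain C where C: "\<And>s. s \<in> {?a..?b} \<Longrightarrow> \<bar>g s\<bar> \<le> C"
  proof -
    have "compact (g ` {?a..?b})"
      by (intro compact_continuous_image continuous_on_subset[OF g]) auto
    then obtain C where "\<forall>x\<in>g ` {?a..?b}. norm x \<le> C"
      using compact_imp_bounded bounded_iff by metis
    then have "\<bar>g s\<bar> \<le> C" if "s \<in> {?a..?b}" for s using that by simp
    then show ?thesis using that by blast
  qed
  define h where "h = (\<lambda>\<sigma> s. (d s)\<^sup>2 * exp (\<sigma> * 2 * C * s))"
  have h': "(h \<sigma> has_real_derivative 2 * (g s + \<sigma> * C) * h \<sigma> s) (at s)" for \<sigma> s
    unfolding h_def by (rule derivative_eq_intros d refl)+ (simp add: algebra_simps power2_eq_square)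
  have hnn: "h \<sigma> s \<ge> 0" for \<sigma> s unfolding h_def by simp
  have h0: "h \<sigma> t0 = 0" for \<sigma> using assms(3) by (simp add: h_def)
  have "\<exists>\<sigma>. h \<sigma> t \<le> h \<sigma> t0"
  proof (cases "t \<le> t0")
    case True
    have "h 1 t \<le> h 1 t0"
    proof (rule DERIV_nonneg_imp_nondecreasing[OF True])
      fix s assume s: "t \<le> s" "s \<le> t0"
      then have "g s + 1 * C \<ge> 0" using C[of s] by auto
      then show "\<exists>y. (h 1 has_real_derivative y) (at s) \<and> 0 \<le> y"
        using h'[of 1 s] hnn[of 1 s] by (metis mult_nonneg_nonneg zero_le_numeral)
    qed
    then show ?thesis by blast
  next
    case False
    have "h (-1) t \<le> h (-1) t0"
    proof (rule DERIV_nonpos_imp_nonincreasing[of t0 t "h (-1)"])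
      show "t0 \<le> t" using False by simp
      fix s assume s: "t0 \<le> s" "s \<le> t"
      then have "g s + (-1) * C \<le> 0" using C[of s] by auto
      then show "\<exists>y. (h (-1) has_real_derivative y) (at s) \<and> y \<le> 0"
        using h'[of "-1" s] hnn[of "-1" s] by (metis mult_nonneg_nonpos mult_nonpos_nonneg zero_le_numeral)
    qed
    then show ?thesis by blast
  qed
  then obtain \<sigma> where "h \<sigma> t \<le> 0" using h0 by metis
  then show ?thesis unfolding h_def by (simp add: mult_le_0_iff)
qed

lemma continuous_nonzero_same_sign:
  fixes f :: "real \<Rightarrow> real"
  assumes "continuous_on UNIV f" "\<And>x. f x \<noteq> 0" shows "f x * f y > 0"
proof -
  have "connected (range f)" using assms(1) by (intro connected_continuous_image connected_UNIV)
  moreover have "0 \<notin> range f" using assms(2) by auto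
  ultimately have "\<not> (f x \<le> 0 \<and> 0 \<le> f y)" "\<not> (f y \<le> 0 \<and> 0 \<le> f x)"
    using connectedD_interval[of "range f"] by blast+
  then show ?thesis by (auto simp: zero_less_mult_iff not_le)
qed

lemma support_pos_interior:
  fixes a :: "'a::euclidean_space"
  assumes a: "norm a = 1" "\<And>x. x \<in> K \<Longrightarrow> a \<bullet> (x - p) \<ge> 0" and x: "x \<in> interior K"
  shows "a \<bullet> (x - p) > 0"
proof -
  obtain e where e: "e > 0" "cball x e \<subseteq> K" using x mem_interior_cball by blast
  have "x - e *\<^sub>R a \<in> K" using e a(1) by (auto simp: dist_norm subset_iff)
  from a(2)[OF this] have "a \<bullet> (x - p) \<ge> e" using a(1) by (simp add: inner_diff_right norm_eq_1)
  then show ?thesis using e(1) by simp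
qed

text \<open>\<open>D p\<close> is determined by \<open>n\<close> on tangent vectors only, where it is minus the shape operator.\<close>

locale convex_body_normal =
  fixes K :: "'a::euclidean_space set" and n :: "'a \<Rightarrow> 'a" and D :: "'a \<Rightarrow> 'a \<Rightarrow> 'a"
  assumes compact_K: "compact K" and convex_K: "convex K"
    and interior_K: "interior K \<noteq> {}"
    and norm_n: "p \<in> frontier K \<Longrightarrow> norm (n p) = 1"
    and supporting: "p \<in> frontier K \<Longrightarrow> x \<in> K \<Longrightarrow> n p \<bullet> (x - p) \<ge> 0"
    and entering: "p \<in> frontier K \<Longrightarrow> n p \<bullet> w > 0 \<Longrightarrow> \<exists>t>0. p + t *\<^sub>R w \<in> interior K"
    and deriv_n: "p \<in> frontier K \<Longrightarrow> (n has_derivative D p) (at p within frontier K)"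
begin

abbreviation (input) S where "S \<equiv> frontier K"

lemma closed_K: "closed K" using compact_K by (rule compact_imp_closed)

lemma S_subset: "S \<subseteq> K" using closed_K by (rule frontier_subset_closed)

lemma K_minus_interior: "x \<in> S \<longleftrightarrow> x \<in> K \<and> x \<notin> interior K"
  using closed_K by (simp add: frontier_def)

lemma n_dot_n: "p \<in> S \<Longrightarrow> n p \<bullet> n p = 1"
  using norm_n[of p] by (simp add: norm_eq_1)

lemma D_linear: "p \<in> S \<Longrightarrow> linear (D p)"
  using deriv_n has_derivative_bounded_linear bounded_linear.linear by blast

lemma interior_pos:
  assumes "p \<in> S" "x \<in> interior K" shows "n p \<bullet> (x - p) > 0"
  by (rule support_pos_interior[OF norm_n[OF assms(1)] supporting[OF assms(1)] assms(2)])

section \<open>Exit times of rays\<close>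

text \<open>The start \<open>z\<close> may be a boundary point or an interior one: chords start on
  \<open>S\<close>, radial projections inside \<open>K\<close>.\<close>

definition enters :: "'a \<Rightarrow> 'a \<Rightarrow> bool" where
  "enters z w \<longleftrightarrow> z \<in> K \<and> w \<noteq> 0 \<and> (\<exists>s>0. z + s *\<^sub>R w \<in> interior K)"

text \<open>The condition \<open>t > 0\<close> discards the start point, which for chords lies on
  \<open>S\<close> itself.\<close>

definition exit_time :: "'a \<Rightarrow> 'a \<Rightarrow> real" where
  "exit_time z w = (THE t. t > 0 \<and> z + t *\<^sub>R w \<in> S)"

text \<open>In a convex set, a segment from a point of \<open>K\<close> to an interior point is
  interior apart from its first end. This is applied from \<open>z\<close> for parameters up to
  \<open>s\<close>, and from the far end \<open>z + r *\<^sub>R w\<close> beyond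
  \<open>s\<close>.\<close>

lemma interior_before:
  assumes "z \<in> K" "z + s *\<^sub>R w \<in> interior K" "z + r *\<^sub>R w \<in> K" "s > 0" "0 < t" "t < r"
  shows "z + t *\<^sub>R w \<in> interior K"
proof (cases "t \<le> s")
  case True
  have "z - (t / s) *\<^sub>R (z - (z + s *\<^sub>R w)) \<in> interior K"
    by (rule mem_interior_convex_shrink[OF convex_K]) (use assms True in auto)
  then show ?thesis using assms by simp
next
  case False
  define e where "e = (r - t) / (r - s)"
  have rs: "r - s > 0" using False assms by simp
  have "(z + r *\<^sub>R w) - e *\<^sub>R ((z + r *\<^sub>R w) - (z + s *\<^sub>R w)) \<in> interior K"
    by (rule mem_interior_convex_shrink[OF convex_K])
       (use assms False in \<open>auto simp: e_def divide_simps\<close>)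
  also have "(z + r *\<^sub>R w) - e *\<^sub>R ((z + r *\<^sub>R w) - (z + s *\<^sub>R w)) = z + (r - e * (r - s)) *\<^sub>R w"
    by (simp add: algebra_simps)
  also have "r - e * (r - s) = t" using rs by (simp add: e_def)
  finally show ?thesis .
qed

lemma exit_time_ex1:
  assumes "enters z w" shows "\<exists>!t. t > 0 \<and> z + t *\<^sub>R w \<in> S"
proof -
  obtain s where z: "z \<in> K" "w \<noteq> 0" and s: "s > 0" "z + s *\<^sub>R w \<in> interior K"
    using assms unfolding enters_def by blast
  obtain d where d: "d > 0" "z + s *\<^sub>R w + d *\<^sub>R w \<in> S"
    using ray_to_frontier[OF compact_imp_bounded[OF compact_K] s(2) z(2)] by blast
  have uniq: "t = t'" if "t > 0" "z + t *\<^sub>R w \<in> S" "t' > 0" "z + t' *\<^sub>R w \<in> S" for t t'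
  proof (rule ccontr)
    have *: False if "u > 0" "z + u *\<^sub>R w \<in> S" "z + u' *\<^sub>R w \<in> S" "u < u'" for u u'
      using interior_before[OF z(1) s(2) _ s(1) that(1,4)] that S_subset K_minus_interior by blast
    assume "t \<noteq> t'"
    then show False using *[of t t'] *[of t' t] that by (cases "t < t'") auto
  qed
  show ?thesis
  proof (rule ex1I[of _ "s + d"])
    show "s + d > 0 \<and> z + (s + d) *\<^sub>R w \<in> S" using s d by (simp add: algebra_simps)
    then show "t = s + d" if "t > 0 \<and> z + t *\<^sub>R w \<in> S" for t using uniq that by blast
  qed
qed

lemma
  assumes "enters z w"
  shows exit_time_pos: "exit_time z w > 0"
    and exit_point_in: "z + exit_time z w *\<^sub>R w \<in> S"
  using theI'[OF exit_time_ex1[OF assms]] unfolding exit_time_def by auto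

lemma exit_time_eq:
  assumes "enters z w" "t > 0" "z + t *\<^sub>R w \<in> S" shows "exit_time z w = t"
  using exit_time_ex1[OF assms(1)] exit_time_pos[OF assms(1)] exit_point_in[OF assms(1)] assms(2,3)
  by blast

lemma
  assumes "enters z w"
  shows interior_before_exit: "0 < t \<Longrightarrow> t < exit_time z w \<Longrightarrow> z + t *\<^sub>R w \<in> interior K"
    and outside_after_exit: "exit_time z w < t \<Longrightarrow> z + t *\<^sub>R w \<notin> K"
proof -
  obtain s where z: "z \<in> K" and s: "s > 0" "z + s *\<^sub>R w \<in> interior K"
    using assms unfolding enters_def by blast
  note e = exit_time_pos[OF assms] exit_point_in[OF assms]
  show "z + t *\<^sub>R w \<in> interior K" if "0 < t" "t < exit_time z w"
    using interior_before[OF z s(2) _ s(1) that] e S_subset by blast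
  show "z + t *\<^sub>R w \<notin> K" if "exit_time z w < t"
    using interior_before[OF z s(2) _ s(1) e(1) that] e K_minus_interior by blast
qed

text \<open>Two open conditions give the two bounds: before the exit the ray is in
  \<open>interior K\<close>, after it in the complement of \<open>K\<close>, and both persist under
  small changes of \<open>z\<close> and \<open>w\<close>.\<close>

lemma exit_time_tendsto:
  assumes en: "\<And>s. enters (z s) (w s)"
    and z: "isCont z t" and w: "isCont w t"
  shows "((\<lambda>s. exit_time (z s) (w s)) \<longlongrightarrow> exit_time (z t) (w t)) (at t)"
proof -
  have lim: "((\<lambda>s. z s + a *\<^sub>R w s) \<longlongrightarrow> z t + a *\<^sub>R w t) (at t)" for a
    using z w by (intro tendsto_intros) (auto simp: isCont_def)
  show ?thesis
  proof (rule order_tendstoI)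
    fix a assume a: "a < exit_time (z t) (w t)"
    show "\<forall>\<^sub>F s in at t. a < exit_time (z s) (w s)"
    proof (cases "a > 0")
      case False
      then show ?thesis using exit_time_pos[OF en] by (intro always_eventually) (smt (verit))
    next
      case True
      have "\<forall>\<^sub>F s in at t. z s + a *\<^sub>R w s \<in> interior K"
        by (rule topological_tendstoD[OF lim open_interior interior_before_exit[OF en True a]])
      then show ?thesis
      proof eventually_elim
        case (elim s)
        then show ?case using outside_after_exit[OF en, of s a] exit_point_in[OF en, of s]
            K_minus_interior interior_subset by (smt (verit) subsetD)
      qed
    qed
  next
    fix a assume a: "exit_time (z t) (w t) < a"
    have "\<forall>\<^sub>F s in at t. z s + a *\<^sub>R w s \<in> - K"
      by (rule topological_tendstoD[OF lim]) (use closed_K outside_after_exit[OF en a] in auto)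
    then show "\<forall>\<^sub>F s in at t. exit_time (z s) (w s) < a"
    proof eventually_elim
      case (elim s)
      moreover have "a > 0" using a exit_time_pos[OF en[of t]] by simp
      ultimately show ?case using interior_before_exit[OF en, of a s] exit_point_in[OF en, of s]
          S_subset interior_subset by (smt (verit) subsetD ComplD)
    qed
  qed
qed

section \<open>Differentiation along the boundary\<close>

lemma n_continuous_within: "p \<in> S \<Longrightarrow> continuous (at p within S) n"
  using deriv_n has_derivative_continuous by blast

lemma n_continuous_on: "continuous_on S n"
  using n_continuous_within by (simp add: continuous_on_eq_continuous_within)

lemma n_along:
  assumes "\<And>t. P t \<in> S" "(P has_vector_derivative a) (at t)"
  shows "((\<lambda>t. n (P t)) has_vector_derivative D (P t) a) (at t)"
proof -
  have "(n has_derivative D (P t)) (at (P t) within P ` UNIV)"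
    by (rule has_derivative_subset[OF deriv_n]) (use assms(1) in auto)
  then show ?thesis using vector_derivative_diff_chain_within[of P a t UNIV n] assms(2)
    by (simp add: o_def)
qed

text \<open>\<open>n (P t) \<bullet> (P s - P t)\<close> is nonnegative and vanishes at
  \<open>s = t\<close>, so it has a minimum there.\<close>

lemma tangent_velocity:
  assumes "\<And>t. P t \<in> S" "(P has_vector_derivative a) (at t)"
  shows "n (P t) \<bullet> a = 0"
proof -
  have "((\<lambda>s. n (P t) \<bullet> (P s - P t)) has_real_derivative (n (P t) \<bullet> (a - 0) + 0 \<bullet> (P t - P t))) (at t)"
    using has_vector_derivative_diff[OF assms(2) has_vector_derivative_const[of "P t"]]
    by (intro has_real_derivative_inner) auto
  from DERIV_local_min[OF this, of 1] show ?thesis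
    using supporting[OF assms(1)] assms(1) S_subset by auto
qed

text \<open>Chords are almost tangent: this replaces the differentiability of a local equation of the
  boundary at the exit point.\<close>

lemma chord_normal_between:
  assumes "x \<in> S" "y \<in> S" shows "\<exists>g \<in> closed_segment (n x) (n y). g \<bullet> (y - x) = 0"
proof -
  \<comment> \<open>Support at the two ends gives opposite signs, so the pairing vanishes somewhere
    on the segment of normals.\<close>
  have "n x \<bullet> (y - x) \<ge> 0" "n y \<bullet> (y - x) \<le> 0"
    using supporting[OF assms(1)] supporting[OF assms(2)] assms S_subset
    by (auto simp: inner_diff_right subset_iff)
  then show ?thesis
    using connected_ivt_hyperplane[of "closed_segment (n x) (n y)" "n y" "n x" "y - x" 0]
    by (auto simp: inner_commute)
qed

text \<open>Implicit differentiation without a local equation: a vector \<open>g s\<close> between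
  the normals at \<open>y t\<close> and \<open>y s\<close> annihilates the chord
  \<open>y s - y t\<close>, which gives an exact linear equation for the increment of the exit time.
  Since \<open>g s\<close> tends to \<open>n (y t)\<close>, the difference quotients converge;
  \<open>ne\<close> says that the ray crosses the boundary transversally.\<close>

lemma exit_time_derivative:
  fixes t :: real
  assumes en: "\<And>s. enters (z s) (w s)"
    and z: "(z has_vector_derivative z') (at t)" and w: "(w has_vector_derivative w') (at t)"
  defines "y \<equiv> \<lambda>s. z s + exit_time (z s) (w s) *\<^sub>R w s"
  assumes ne: "n (y t) \<bullet> w t \<noteq> 0"
  shows "((\<lambda>s. exit_time (z s) (w s)) has_real_derivative
     - (n (y t) \<bullet> (z' + exit_time (z t) (w t) *\<^sub>R w')) / (n (y t) \<bullet> w t)) (at t)"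
proof -
  define E where "E = (\<lambda>s. exit_time (z s) (w s))"
  have zc: "isCont z t" and wc: "isCont w t"
    using z w has_vector_derivative_continuous by blast+
  have Ec: "isCont E t" unfolding E_def isCont_def by (rule exit_time_tendsto[OF en zc wc])
  have yS: "y s \<in> S" for s unfolding y_def by (rule exit_point_in[OF en])
  have yc: "isCont y t" unfolding y_def using zc wc Ec unfolding E_def by (intro continuous_intros)
  have nyc: "isCont (\<lambda>s. n (y s)) t"
    using continuous_on_compose2[OF n_continuous_on, of UNIV y] yc
      continuous_within_compose2[of t UNIV y n] n_continuous_within[OF yS]
      continuous_within_subset[of "y t" S n "y ` UNIV"] yS by auto
  obtain g where g: "\<And>s. g s \<in> closed_segment (n (y t)) (n (y s))" "\<And>s. g s \<bullet> (y s - y t) = 0"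
    using chord_normal_between[OF yS yS] by metis
  have gl: "(g \<longlongrightarrow> n (y t)) (at t)"
  proof (rule metric_tendsto_imp_tendsto[of "\<lambda>s. n (y s)" "n (y t)"])
    show "((\<lambda>s. n (y s)) \<longlongrightarrow> n (y t)) (at t)" using nyc by (simp add: isCont_def)
    show "\<forall>\<^sub>F s in at t. dist (g s) (n (y t)) \<le> dist (n (y s)) (n (y t))"
      using segment_bound1[OF g(1)] by (intro always_eventually) (auto simp: dist_norm)
  qed
  have gw: "((\<lambda>s. g s \<bullet> w s) \<longlongrightarrow> n (y t) \<bullet> w t) (at t)"
    using gl wc by (intro tendsto_intros) (auto simp: isCont_def)
  have key: "(E s - E t) * (g s \<bullet> w s) = - (g s \<bullet> ((z s - z t) + E t *\<^sub>R (w s - w t)))" for s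
  proof -
    have "y s - y t = (E s - E t) *\<^sub>R w s + ((z s - z t) + E t *\<^sub>R (w s - w t))"
      unfolding y_def E_def by (simp add: algebra_simps)
    then show ?thesis using g(2)[of s] by (simp add: inner_add_right)
  qed
  have "((\<lambda>s. - (g s \<bullet> ((z s - z t) /\<^sub>R (s - t) + E t *\<^sub>R ((w s - w t) /\<^sub>R (s - t)))) / (g s \<bullet> w s))
     \<longlongrightarrow> - (n (y t) \<bullet> (z' + E t *\<^sub>R w')) / (n (y t) \<bullet> w t)) (at t)"
    using z w unfolding has_vector_derivative_at_iff_difference_quotient
    by (intro tendsto_intros gl gw ne)
  moreover have "\<forall>\<^sub>F s in at t. - (g s \<bullet> ((z s - z t) /\<^sub>R (s - t) + E t *\<^sub>R ((w s - w t) /\<^sub>R (s - t)))) / (g s \<bullet> w s)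
      = (E s - E t) / (s - t)"
  proof -
    have "\<forall>\<^sub>F s in at t. g s \<bullet> w s \<noteq> 0" by (rule tendsto_imp_eventually_ne[OF gw ne])
    then show ?thesis
    proof eventually_elim
      case (elim s)
      have "- (g s \<bullet> ((z s - z t) /\<^sub>R (s - t) + E t *\<^sub>R ((w s - w t) /\<^sub>R (s - t))))
         = - (g s \<bullet> ((z s - z t) + E t *\<^sub>R (w s - w t))) / (s - t)"
        by (simp add: inner_add_right divide_simps)
      also have "\<dots> = (E s - E t) * (g s \<bullet> w s) / (s - t)" using key by simp
      finally show ?case using elim by simp
    qed
  qed
  ultimately have "((\<lambda>s. (E s - E t) / (s - t)) \<longlongrightarrow> - (n (y t) \<bullet> (z' + E t *\<^sub>R w')) / (n (y t) \<bullet> w t)) (at t)"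
    by (rule Lim_transform_eventually)
  then show ?thesis unfolding has_field_derivative_iff E_def .
qed

section \<open>Curves on the boundary by radial projection\<close>

text \<open>\<open>P\<close> is the radial projection of \<open>c\<close> to the boundary from the
  interior point \<open>o'\<close>. The radial part \<open>l\<close> of its velocity is left
  undetermined here; tangency fixes it later.\<close>

lemma boundary_curve:
  assumes o: "o' \<in> interior K" and c: "\<And>t. c t \<noteq> o'" and d: "\<And>t. (c has_vector_derivative c' t) (at t)"
  defines "P \<equiv> \<lambda>t. o' + exit_time o' (c t - o') *\<^sub>R (c t - o')"
  shows "P t \<in> S"
    and "\<exists>l. (P has_vector_derivative exit_time o' (c t - o') *\<^sub>R c' t + l *\<^sub>R (c t - o')) (at t)"
    and "c t \<in> S \<Longrightarrow> P t = c t \<and> exit_time o' (c t - o') = 1"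
proof -
  have en: "enters o' (c t - o')" for t
  proof -
    obtain e where e: "e > 0" "ball o' e \<subseteq> interior K" using o open_contains_ball by blast
    have nz: "norm (c t - o') > 0" using c[of t] by simp
    have "o' + (e / 2 / norm (c t - o')) *\<^sub>R (c t - o') \<in> interior K"
      using e nz by (intro subsetD[OF e(2)]) (simp add: dist_norm)
    then show ?thesis unfolding enters_def using o c[of t] interior_subset e nz
      by (auto intro!: exI[of _ "e / 2 / norm (c t - o')"])
  qed
  show PS: "P t \<in> S" for t unfolding P_def by (rule exit_point_in[OF en])
  \<comment> \<open>The interior point lies strictly on the inner side of the supporting hyperplane
    at \<open>P t\<close>, so the ray from it crosses transversally.\<close>
  have ne: "n (P t) \<bullet> (c t - o') \<noteq> 0"
  proof -
    have "n (P t) \<bullet> (o' - P t) > 0" by (rule interior_pos[OF PS o])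
    then show ?thesis by (auto simp: P_def inner_diff_right inner_add_right)
  qed
  have dw: "((\<lambda>t. c t - o') has_vector_derivative c' t) (at t)"
    using has_vector_derivative_diff[OF d has_vector_derivative_const] by simp
  have "\<exists>l. ((\<lambda>s. exit_time o' (c s - o')) has_real_derivative l) (at t)"
    using exit_time_derivative[OF en has_vector_derivative_const dw] ne unfolding P_def by blast
  then obtain l where l: "((\<lambda>s. exit_time o' (c s - o')) has_real_derivative l) (at t)" by blast
  have "(P has_vector_derivative 0 + (exit_time o' (c t - o') *\<^sub>R c' t + l *\<^sub>R (c t - o'))) (at t)"
    unfolding P_def by (intro has_vector_derivative_add has_vector_derivative_const
      has_vector_derivative_scaleR[OF l dw])
  then show "\<exists>l. (P has_vector_derivative exit_time o' (c t - o') *\<^sub>R c' t + l *\<^sub>R (c t - o')) (at t)"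
    by auto
  show "P t = c t \<and> exit_time o' (c t - o') = 1" if "c t \<in> S"
    using exit_time_eq[OF en, of 1 t] that by (simp add: P_def)
qed

text \<open>The line \<open>p + t *\<^sub>R a\<close> is projected radially. It misses
  \<open>o'\<close>, which lies strictly inside the supporting hyperplane; the radial part of the
  velocity vanishes because the velocity is tangent while \<open>p - o'\<close> is not.\<close>

lemma curve_with_velocity:
  assumes "p \<in> S" "n p \<bullet> a = 0"
  obtains P where "\<And>t::real. P t \<in> S" "P 0 = p" "(P has_vector_derivative a) (at 0)"
proof -
  obtain o' where o: "o' \<in> interior K" using interior_K by blast
  define c where "c = (\<lambda>t. p + t *\<^sub>R a)"
  have np: "n p \<bullet> (o' - p) > 0" by (rule interior_pos[OF assms(1) o])
  have ne: "c t \<noteq> o'" for t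
  proof
    assume "c t = o'"
    then have "o' - p = t *\<^sub>R a" by (auto simp: c_def)
    then show False using np assms(2) by simp
  qed
  have d: "(c has_vector_derivative a) (at t)" for t
    unfolding c_def by (auto intro!: derivative_eq_intros)
  note bc = boundary_curve[OF o ne d]
  let ?P = "\<lambda>t. o' + exit_time o' (c t - o') *\<^sub>R (c t - o')"
  have c0: "c 0 = p" by (simp add: c_def)
  have P0: "?P 0 = p" "exit_time o' (p - o') = 1" using bc(3)[of 0] assms(1) c0 by auto
  obtain l where l: "(?P has_vector_derivative 1 *\<^sub>R a + l *\<^sub>R (p - o')) (at 0)"
    using bc(2)[of 0] c0 P0 by auto
  have "n (?P 0) \<bullet> (1 *\<^sub>R a + l *\<^sub>R (p - o')) = 0" by (rule tangent_velocity[OF bc(1) l])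
  then have "l * (n p \<bullet> (p - o')) = 0" unfolding P0(1) using assms(2) by (simp add: inner_add_right)
  then have "l = 0" using np by (auto simp: inner_diff_right)
  then show ?thesis using that[of ?P] bc(1) P0 l by simp
qed

lemma D_tangent:
  assumes "p \<in> S" "n p \<bullet> a = 0" shows "n p \<bullet> D p a = 0"
proof -
  obtain P where P: "\<And>t. P t \<in> S" "P 0 = p" "(P has_vector_derivative a) (at 0)"
    using curve_with_velocity[OF assms] by blast
  have nd: "((\<lambda>t. n (P t)) has_vector_derivative D p a) (at 0)" using n_along[OF P(1,3)] P(2) by simp
  have "((\<lambda>t. n (P t) \<bullet> n (P t)) has_real_derivative (n p \<bullet> D p a + D p a \<bullet> n p)) (at 0)"
    using has_real_derivative_inner[OF nd nd] P(2) by simp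
  moreover have "(\<lambda>t. n (P t) \<bullet> n (P t)) = (\<lambda>t. 1)" using n_dot_n P(1) by auto
  ultimately have "n p \<bullet> D p a + D p a \<bullet> n p = 0" using DERIV_unique[OF _ DERIV_const] by metis
  then show ?thesis by (simp add: inner_commute)
qed

end

section \<open>Bodies with the equal-angle property\<close>

text \<open>Signs replace the unsigned angles: \<open>q - p\<close> points inwards at
  \<open>p\<close> and outwards at \<open>q\<close>, whence the minus sign. Positive curvature
  enters as injectivity of \<open>D p\<close> on tangent vectors.\<close>

locale equal_angle_body = convex_body_normal K n D
  for K :: "'a::euclidean_space set" and n :: "'a \<Rightarrow> 'a" and D :: "'a \<Rightarrow> 'a \<Rightarrow> 'a" +
  fixes \<delta> :: real
  assumes dim: "DIM('a) \<ge> 3"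
    and delta: "0 < \<delta>" "\<delta> < pi / 2"
    and D_symmetric: "p \<in> frontier K \<Longrightarrow> n p \<bullet> a = 0 \<Longrightarrow> n p \<bullet> b = 0 \<Longrightarrow> D p a \<bullet> b = a \<bullet> D p b"
    and D_injective: "p \<in> frontier K \<Longrightarrow> n p \<bullet> a = 0 \<Longrightarrow> D p a = 0 \<Longrightarrow> a = 0"
    and equal_angle: "p \<in> frontier K \<Longrightarrow> q \<in> frontier K \<Longrightarrow> p \<noteq> q \<Longrightarrow>
      n p \<bullet> (q - p) = sin \<delta> * norm (q - p) \<Longrightarrow> n q \<bullet> (q - p) = - sin \<delta> * norm (q - p)"
begin

lemma sin_pos: "sin \<delta> > 0" and cos_pos: "cos \<delta> > 0"
  using delta by (auto intro: sin_gt_zero cos_gt_zero)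

section \<open>The chord map and its reversal\<close>

definition unit_tangent :: "'a \<Rightarrow> 'a \<Rightarrow> bool" where
  "unit_tangent p v \<longleftrightarrow> p \<in> S \<and> norm v = 1 \<and> n p \<bullet> v = 0"

definition dir :: "'a \<Rightarrow> 'a \<Rightarrow> 'a" where
  "dir p v = cos \<delta> *\<^sub>R v + sin \<delta> *\<^sub>R n p"

definition len :: "'a \<Rightarrow> 'a \<Rightarrow> real" where
  "len p v = exit_time p (dir p v)"

definition tip :: "'a \<Rightarrow> 'a \<Rightarrow> 'a" where
  "tip p v = p + len p v *\<^sub>R dir p v"

definition out :: "'a \<Rightarrow> 'a \<Rightarrow> 'a" where
  "out p v = (dir p v + sin \<delta> *\<^sub>R n (tip p v)) /\<^sub>R cos \<delta>"

lemma unit_tangentD: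
  assumes "unit_tangent p v"
  shows "p \<in> S" "v \<bullet> v = 1" "n p \<bullet> v = 0" "v \<bullet> n p = 0" "n p \<bullet> n p = 1"
  using assms n_dot_n unfolding unit_tangent_def by (auto simp: norm_eq_1 inner_commute)

lemma unit_tangent_minus [simp]: "unit_tangent p (- v) \<longleftrightarrow> unit_tangent p v"
  by (simp add: unit_tangent_def)

lemma sin_cos_sq: "sin \<delta> * sin \<delta> + cos \<delta> * cos \<delta> = 1"
  using sin_cos_squared_add[of \<delta>] by (simp add: power2_eq_square)

lemma dir_inner:
  assumes "unit_tangent p v"
  shows "dir p v \<bullet> dir p v = 1" "n p \<bullet> dir p v = sin \<delta>" "dir p v \<bullet> v = cos \<delta>"
  using unit_tangentD[OF assms] sin_cos_sq
  by (auto simp: dir_def inner_add_left inner_add_right inner_commute algebra_simps)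

lemma enters_dir:
  assumes "unit_tangent p v" shows "enters p (dir p v)"
  using entering[of p "dir p v"] dir_inner[OF assms] sin_pos unit_tangentD[OF assms] S_subset
  unfolding enters_def by auto

lemma
  assumes "unit_tangent p v"
  shows len_pos: "len p v > 0" and tip_in: "tip p v \<in> S"
  using exit_time_pos[OF enters_dir[OF assms]] exit_point_in[OF enters_dir[OF assms]]
  by (auto simp: len_def tip_def)

lemma n_tip_dir:
  assumes "unit_tangent p v" shows "n (tip p v) \<bullet> dir p v = - sin \<delta>"
proof -
  have n1: "norm (dir p v) = 1" using dir_inner(1)[OF assms] by (simp add: norm_eq_1)
  have eq: "tip p v - p = len p v *\<^sub>R dir p v" by (simp add: tip_def)
  have "n (tip p v) \<bullet> (tip p v - p) = - sin \<delta> * norm (tip p v - p)"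
  proof (rule equal_angle)
    show "p \<in> S" "tip p v \<in> S" using assms tip_in unit_tangentD by auto
    show "p \<noteq> tip p v" using len_pos[OF assms] n1 by (auto simp: tip_def)
    show "n p \<bullet> (tip p v - p) = sin \<delta> * norm (tip p v - p)"
      using dir_inner[OF assms] len_pos[OF assms] n1 by (simp add: eq)
  qed
  then have "len p v * (n (tip p v) \<bullet> dir p v) = len p v * - sin \<delta>"
    using len_pos[OF assms] n1 by (simp add: eq)
  then show ?thesis using len_pos[OF assms] by (subst (asm) mult_cancel_left) simp
qed

lemma out_inner:
  assumes "unit_tangent p v"
  shows "out p v \<bullet> out p v = 1" "n (tip p v) \<bullet> out p v = 0" "dir p v \<bullet> out p v = cos \<delta>"
    "n (tip p v) \<bullet> n (tip p v) = 1"
    "dir p v = cos \<delta> *\<^sub>R out p v - sin \<delta> *\<^sub>R n (tip p v)"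
proof -
  let ?q = "tip p v" and ?w = "dir p v"
  note [simp] = dir_inner(1)[OF assms] n_tip_dir[OF assms]
  have wn: "?w \<bullet> n ?q = - sin \<delta>" using n_tip_dir[OF assms] by (simp add: inner_commute)
  show nn: "n ?q \<bullet> n ?q = 1" by (rule n_dot_n[OF tip_in[OF assms]])
  have cs: "cos \<delta> \<noteq> 0" using cos_pos by simp
  show eq: "?w = cos \<delta> *\<^sub>R out p v - sin \<delta> *\<^sub>R n ?q" using cs by (simp add: out_def)
  show 1: "n ?q \<bullet> out p v = 0" by (simp add: out_def inner_add_right nn)
  show 2: "?w \<bullet> out p v = cos \<delta>"
    using sin_cos_sq cs by (simp add: out_def inner_add_right wn field_simps)
  show "out p v \<bullet> out p v = 1"
    using 2 1 cs by (subst (asm) eq) (simp add: inner_diff_left)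
qed

text \<open>The chord run backwards leaves \<open>tip p v\<close> in the direction
  \<open>- dir p v\<close>, which is the \<open>dir\<close> of \<open>- out p v\<close> by the
  decomposition of \<open>dir p v\<close> at the tip. This transfers facts about the foot of a chord
  to its tip.\<close>

lemma reverse:
  assumes "unit_tangent p v"
  shows "unit_tangent (tip p v) (- out p v)" "dir (tip p v) (- out p v) = - dir p v"
    "len (tip p v) (- out p v) = len p v" "tip (tip p v) (- out p v) = p"
    "out (tip p v) (- out p v) = - v"
proof -
  let ?q = "tip p v" and ?u = "- out p v"
  show ut: "unit_tangent ?q ?u"
    using out_inner[OF assms] tip_in[OF assms] by (simp add: unit_tangent_def norm_eq_1)
  show d: "dir ?q ?u = - dir p v" using out_inner(5)[OF assms] by (simp add: dir_def[of ?q])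
  have p: "?q + len p v *\<^sub>R dir ?q ?u = p" by (simp add: d) (simp add: tip_def)
  show l: "len ?q ?u = len p v"
    unfolding len_def[of ?q] by (rule exit_time_eq[OF enters_dir[OF ut] len_pos[OF assms]])
      (use p unit_tangentD(1)[OF assms] in simp)
  show t: "tip ?q ?u = p" unfolding tip_def[of ?q] l by (rule p)
  show "out ?q ?u = - v"
    using cos_pos by (simp add: out_def[of ?q] t d) (simp add: dir_def)
qed

section \<open>Tangent fields and variations of chords\<close>

lemma exists_unit_tangent:
  assumes "p \<in> S" obtains v where "unit_tangent p v"
proof -
  obtain y where "y \<noteq> 0" "orthogonal (n p) y"
    using orthogonal_to_vector_exists[of "n p"] dim by auto
  then have "unit_tangent p (y /\<^sub>R norm y)"
    using assms by (simp add: unit_tangent_def orthogonal_def)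
  then show ?thesis by (rule that)
qed

text \<open>The vector \<open>v\<close> is projected to the tangent hyperplanes along
  \<open>P\<close> and normalised. As \<open>v\<close> is orthogonal to the normal at
  \<open>t0\<close>, the length \<open>N\<close> is stationary there, so normalising does not change
  the derivative.\<close>

lemma tangent_field:
  assumes P: "\<And>t. P t \<in> S" "(P has_vector_derivative a) (at t0)" and v: "unit_tangent (P t0) v"
  obtains V where "V t0 = v" "\<And>t. unit_tangent (P t) (V t)"
    "(V has_vector_derivative - (v \<bullet> D (P t0) a) *\<^sub>R n (P t0)) (at t0)"
proof -
  define X where "X = (\<lambda>t. v - (v \<bullet> n (P t)) *\<^sub>R n (P t))"
  define N where "N = (\<lambda>t. sqrt (1 - (v \<bullet> n (P t))\<^sup>2))"
  \<comment> \<open>Where the projection vanishes, an arbitrary unit tangent vector keeps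
    \<open>V\<close> a unit tangent field for all parameters; near \<open>t0\<close> this case does
    not occur.\<close>
  define V where "V = (\<lambda>t. if X t = 0 then SOME x. unit_tangent (P t) x else X t /\<^sub>R norm (X t))"
  let ?n = "n (P t0)" and ?Dn = "D (P t0) a"
  note v' = unit_tangentD[OF v]
  have nd: "((\<lambda>t. n (P t)) has_vector_derivative ?Dn) (at t0)" by (rule n_along[OF P])
  have X0: "X t0 = v" using v' by (simp add: X_def)
  have vn: "((\<lambda>t. v \<bullet> n (P t)) has_real_derivative v \<bullet> ?Dn) (at t0)"
    using has_real_derivative_inner[OF has_vector_derivative_const[of v] nd] by simp
  have X': "(X has_vector_derivative - (v \<bullet> ?Dn) *\<^sub>R ?n) (at t0)"
    unfolding X_def
    using has_vector_derivative_diff[OF has_vector_derivative_const[of v] has_vector_derivative_scaleR[OF vn nd]]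
      v'(4) by simp
  have nX: "norm (X t) = N t" for t
  proof -
    have "X t \<bullet> X t = 1 - (v \<bullet> n (P t))\<^sup>2"
      using v'(2) n_dot_n[OF P(1), of t]
      by (simp add: X_def inner_diff_left inner_diff_right power2_eq_square inner_commute algebra_simps)
    then show ?thesis by (simp add: N_def norm_eq_sqrt_inner)
  qed
  have N': "(N has_real_derivative 0) (at t0)"
    unfolding N_def by (rule derivative_eq_intros vn refl | use v'(4) in force)+
  have N0: "N t0 = 1" using nX[of t0] X0 v by (simp add: unit_tangent_def)
  have Y': "((\<lambda>t. inverse (N t) *\<^sub>R X t) has_vector_derivative - (v \<bullet> ?Dn) *\<^sub>R ?n) (at t0)"
    using has_vector_derivative_scaleR[OF DERIV_inverse_fun[OF N'] X'] N0 by simp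
  have ev: "\<forall>\<^sub>F t in nhds t0. V t = inverse (N t) *\<^sub>R X t"
  proof -
    have "isCont X t0" using X' has_vector_derivative_continuous by blast
    then have "(X \<longlongrightarrow> X t0) (nhds t0)" unfolding isCont_def tendsto_at_iff_tendsto_nhds .
    then have "\<forall>\<^sub>F t in nhds t0. X t \<noteq> 0"
      by (rule tendsto_imp_eventually_ne) (use v'(2) X0 in auto)
    then show ?thesis by eventually_elim (simp add: V_def nX)
  qed
  have V0: "V t0 = v" using eventually_nhds_x_imp_x[OF ev] N0 X0 by simp
  have "(V has_vector_derivative - (v \<bullet> ?Dn) *\<^sub>R ?n) (at t0)"
    using has_vector_derivative_cong_ev[of UNIV V "\<lambda>t. inverse (N t) *\<^sub>R X t" t0] ev Y'
      eventually_nhds_x_imp_x[OF ev] by (auto elim: eventually_mono)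
  moreover have "unit_tangent (P t) (V t)" for t
  proof (cases "X t = 0")
    case True
    obtain x where "unit_tangent (P t) x" using exists_unit_tangent[OF P(1)] .
    then have "unit_tangent (P t) (SOME x. unit_tangent (P t) x)" by (rule someI)
    then show ?thesis using True by (simp add: V_def)
  next
    case False
    have "n (P t) \<bullet> X t = 0" using n_dot_n[OF P(1), of t]
      by (simp add: X_def inner_diff_right inner_commute)
    then show ?thesis using False P(1) by (simp add: V_def unit_tangent_def)
  qed
  ultimately show ?thesis using that V0 by blast
qed

text \<open>The linearised constraints on \<open>(p, w, q, L)\<close>, with velocities \<open>(a, \<omega>, b, l)\<close>, for chords that
  keep the angle \<open>\<delta>\<close> at both ends.\<close>

definition variation :: "'a \<Rightarrow> 'a \<Rightarrow> 'a \<Rightarrow> 'a \<Rightarrow> 'a \<Rightarrow> real \<Rightarrow> bool" where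
  "variation p v a \<omega> b l \<longleftrightarrow> n p \<bullet> a = 0 \<and> n (tip p v) \<bullet> b = 0 \<and>
     b = a + l *\<^sub>R dir p v + len p v *\<^sub>R \<omega> \<and> \<omega> \<bullet> dir p v = 0 \<and>
     n p \<bullet> \<omega> = - (dir p v \<bullet> D p a) \<and> n (tip p v) \<bullet> \<omega> = - (dir p v \<bullet> D (tip p v) b)"

text \<open>The constraints are the derivatives of constant products: \<open>dir\<close> with
  itself, and with the normals at foot and tip. The equal-angle property enters through the last
  one, which is constant by \<open>n_tip_dir\<close>.\<close>

lemma variation_of_curve:
  assumes ut: "\<And>t. unit_tangent (P t) (V t)"
    and P: "(P has_vector_derivative a) (at t)" and V: "(V has_vector_derivative \<nu>) (at t)"
  shows "\<exists>l b. ((\<lambda>s. len (P s) (V s)) has_real_derivative l) (at t) \<and>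
      variation (P t) (V t) a (cos \<delta> *\<^sub>R \<nu> + sin \<delta> *\<^sub>R D (P t) a) b l"
proof -
  let ?\<omega> = "cos \<delta> *\<^sub>R \<nu> + sin \<delta> *\<^sub>R D (P t) a"
  have PS: "P s \<in> S" for s using ut unit_tangentD by blast
  have nP: "((\<lambda>s. n (P s)) has_vector_derivative D (P t) a) (at t)" by (rule n_along[OF PS P])
  have W: "((\<lambda>s. dir (P s) (V s)) has_vector_derivative ?\<omega>) (at t)"
    unfolding dir_def by (intro has_vector_derivative_add bounded_linear.has_vector_derivative[OF bounded_linear_scaleR_right] V nP)
  have "n (P t + exit_time (P t) (dir (P t) (V t)) *\<^sub>R dir (P t) (V t)) \<bullet> dir (P t) (V t) \<noteq> 0"
    using n_tip_dir[OF ut, of t] sin_pos unfolding tip_def len_def by simp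
  from exit_time_derivative[OF enters_dir[OF ut] P W this]
  obtain l where l: "((\<lambda>s. len (P s) (V s)) has_real_derivative l) (at t)" unfolding len_def by blast
  let ?b = "a + l *\<^sub>R dir (P t) (V t) + len (P t) (V t) *\<^sub>R ?\<omega>"
  have Q: "((\<lambda>s. tip (P s) (V s)) has_vector_derivative ?b) (at t)"
    unfolding tip_def using has_vector_derivative_add[OF P has_vector_derivative_scaleR[OF l W]]
    by (simp add: algebra_simps)
  have QS: "tip (P s) (V s) \<in> S" for s by (rule tip_in[OF ut])
  have nQ: "((\<lambda>s. n (tip (P s) (V s))) has_vector_derivative D (tip (P t) (V t)) ?b) (at t)"
    by (rule n_along[OF QS Q])
  have const: "x \<bullet> g' + f' \<bullet> y = 0"
    if "(f has_vector_derivative f') (at t)" "(g has_vector_derivative g') (at t)"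
      "\<And>s. f s \<bullet> g s = c" "f t = x" "g t = y" for f g :: "real \<Rightarrow> 'a" and f' g' c x y
    using has_real_derivative_inner[OF that(1,2)] that(3-5) DERIV_unique[OF _ DERIV_const[of c]] by simp
  have 1: "dir (P t) (V t) \<bullet> ?\<omega> + ?\<omega> \<bullet> dir (P t) (V t) = 0"
    by (rule const[OF W W dir_inner(1)[OF ut]]) auto
  have 2: "n (P t) \<bullet> ?\<omega> + D (P t) a \<bullet> dir (P t) (V t) = 0"
    by (rule const[OF nP W dir_inner(2)[OF ut]]) auto
  have 3: "n (tip (P t) (V t)) \<bullet> ?\<omega> + D (tip (P t) (V t)) ?b \<bullet> dir (P t) (V t) = 0"
    by (rule const[OF nQ W n_tip_dir[OF ut]]) auto
  have "variation (P t) (V t) a ?\<omega> ?b l"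
    unfolding variation_def
    using tangent_velocity[OF PS P] tangent_velocity[OF QS Q] 1 2 3 by (simp add: inner_commute)
  then show ?thesis using l by blast
qed

lemma variation_reverse:
  assumes "unit_tangent p v" "variation (tip p v) (- out p v) a \<omega> b l"
  shows "variation p v b (- \<omega>) a l"
  using assms(2) unfolding variation_def reverse[OF assms(1)]
  by (auto simp: inner_diff_right algebra_simps)

text \<open>The invariance of the symplectic form under the chord map, with the second fundamental
  forms already cancelled.\<close>

lemma variation_antisym:
  assumes "variation p v a \<omega> b l" "variation p v a' \<omega>' b' l'"
  shows "\<omega> \<bullet> b' - \<omega>' \<bullet> b = \<omega> \<bullet> a' - \<omega>' \<bullet> a"
proof -
  have 1: "b = a + l *\<^sub>R dir p v + len p v *\<^sub>R \<omega>" "\<omega> \<bullet> dir p v = 0"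
    "b' = a' + l' *\<^sub>R dir p v + len p v *\<^sub>R \<omega>'" "\<omega>' \<bullet> dir p v = 0"
    using assms unfolding variation_def by auto
  \<comment> \<open>The parts along \<open>dir p v\<close> are orthogonal to \<open>\<omega>\<close>
    and \<open>\<omega>'\<close>, and the two terms
    \<open>len p v * (\<omega> \<bullet> \<omega>')\<close> cancel.\<close>
  show ?thesis unfolding 1(1,3) by (simp add: inner_add_right 1(2,4) inner_commute)
qed

text \<open>The tip moves tangentially, so pairing its velocity with the normal at the tip leaves an
  equation for \<open>l\<close>.\<close>

lemma variation_length_rate:
  assumes "unit_tangent p v" "variation p v a \<omega> b l"
  shows "l * sin \<delta> = n (tip p v) \<bullet> (a + len p v *\<^sub>R \<omega>)"
proof -
  have "n (tip p v) \<bullet> (a + l *\<^sub>R dir p v + len p v *\<^sub>R \<omega>) = 0"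
    using assms(2) unfolding variation_def by metis
  then show ?thesis using n_tip_dir[OF assms(1)] by (simp add: inner_add_right)
qed

text \<open>The first-order change of the chord direction when \<open>v\<close> is carried along \<open>a\<close> by parallel
  transport, i.e. with purely normal derivative.\<close>

definition transport :: "'a \<Rightarrow> 'a \<Rightarrow> 'a \<Rightarrow> 'a" where
  "transport p v a = sin \<delta> *\<^sub>R D p a - (cos \<delta> * (v \<bullet> D p a)) *\<^sub>R n p"

lemma transport_variation_of_curve:
  assumes P: "\<And>t. P t \<in> S" "(P has_vector_derivative a) (at t0)" and v: "unit_tangent (P t0) v"
  obtains V l b where "V t0 = v" "\<And>t. unit_tangent (P t) (V t)"
    "((\<lambda>s. len (P s) (V s)) has_real_derivative l) (at t0)"
    "variation (P t0) v a (transport (P t0) v a) b l"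
    "(V has_vector_derivative - (v \<bullet> D (P t0) a) *\<^sub>R n (P t0)) (at t0)"
proof -
  obtain V where V: "V t0 = v" "\<And>t. unit_tangent (P t) (V t)"
    "(V has_vector_derivative - (v \<bullet> D (P t0) a) *\<^sub>R n (P t0)) (at t0)"
    using tangent_field[OF P v] by metis
  have "cos \<delta> *\<^sub>R (- (v \<bullet> D (P t0) a) *\<^sub>R n (P t0)) + sin \<delta> *\<^sub>R D (P t0) a = transport (P t0) v a"
    by (simp add: transport_def)
  then show ?thesis using variation_of_curve[OF V(2) P(2) V(3)] V that by metis
qed

lemma transport_variation:
  assumes "unit_tangent p v" "n p \<bullet> a = 0"
  shows "\<exists>b l. variation p v a (transport p v a) b l"
proof -
  obtain P where P: "\<And>t::real. P t \<in> S" "P 0 = p" "(P has_vector_derivative a) (at 0)"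
    using curve_with_velocity[OF unit_tangentD(1)[OF assms(1)] assms(2)] by blast
  show ?thesis using transport_variation_of_curve[OF P(1,3)] assms P(2) by metis
qed

section \<open>Turning the direction at a fixed foot\<close>

lemma circle:
  assumes "unit_tangent p v" "unit_tangent p \<eta>" "v \<bullet> \<eta> = 0"
  defines "c \<equiv> \<lambda>t. cos t *\<^sub>R v + sin t *\<^sub>R \<eta>" and "c' \<equiv> \<lambda>t. - sin t *\<^sub>R v + cos t *\<^sub>R \<eta>"
  shows "unit_tangent p (c t)" "unit_tangent p (c' t)" "c t \<bullet> c' t = 0"
    "(c has_vector_derivative c' t) (at t)"
proof -
  note [simp] = unit_tangentD[OF assms(1)] unit_tangentD[OF assms(2)] assms(3)
  have ev: "\<eta> \<bullet> v = 0" using assms(3) by (simp only: inner_commute)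
  have sc: "sin t * sin t + cos t * cos t = 1" "cos t * cos t + sin t * sin t = 1"
    using sin_cos_squared_add[of t] by (simp_all add: power2_eq_square)
  show "unit_tangent p (c t)" "unit_tangent p (c' t)" "c t \<bullet> c' t = 0"
    unfolding unit_tangent_def norm_eq_1 c_def c'_def
    by (auto simp: inner_add_left inner_add_right inner_diff_right inner_diff_left ev sc)
  show "(c has_vector_derivative c' t) (at t)"
    unfolding c_def c'_def by (auto intro!: derivative_eq_intros simp: has_real_derivative_iff_has_vector_derivative[symmetric])
qed

lemma vertical_variation_of_curve:
  assumes "\<And>t. unit_tangent p (c t)" "(c has_vector_derivative \<eta>) (at t)"
  shows "\<exists>l b. ((\<lambda>s. len p (c s)) has_real_derivative l) (at t) \<and>
      variation p (c t) 0 (cos \<delta> *\<^sub>R \<eta>) b l"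
proof -
  have "D p 0 = 0" using linear_0[OF D_linear[of p]] assms(1) unit_tangentD(1) by blast
  then show ?thesis
    using variation_of_curve[of "\<lambda>_. p" c, OF assms(1) has_vector_derivative_const assms(2)] by simp
qed

lemma vertical_variation:
  assumes "unit_tangent p v" "unit_tangent p \<eta>" "v \<bullet> \<eta> = 0"
  shows "\<exists>b l. variation p v 0 (cos \<delta> *\<^sub>R \<eta>) b l"
proof -
  note c = circle[OF assms]
  show ?thesis using vertical_variation_of_curve[OF c(1,4), of 0] by auto
qed

section \<open>The image of the geodesic spray\<close>

text \<open>\<open>\<omega> \<bullet> dir p v = 0\<close> expresses
  \<open>\<omega> \<bullet> v\<close> through \<open>n p \<bullet> \<omega>\<close>, which the fixed
  angle at \<open>p\<close> expresses through \<open>D p a\<close>; symmetry of \<open>D p\<close>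
  does the rest. Hence the spray \<open>(v, transport p v v)\<close> annihilates the pairing in
  \<open>variation_antisym\<close>.\<close>

lemma transport_spray_inner:
  assumes "unit_tangent p v" "variation p v a \<omega> b l"
  shows "transport p v v \<bullet> a = \<omega> \<bullet> v"
proof -
  note v = unit_tangentD[OF assms(1)]
  have a: "n p \<bullet> a = 0" "\<omega> \<bullet> dir p v = 0" "n p \<bullet> \<omega> = - (dir p v \<bullet> D p a)"
    using assms(2) unfolding variation_def by auto
  have "cos \<delta> * (\<omega> \<bullet> v) = - sin \<delta> * (n p \<bullet> \<omega>)"
    using a(2) by (simp add: dir_def inner_add_right inner_commute)
  also have "\<dots> = sin \<delta> * (cos \<delta> * (v \<bullet> D p a))"
    using a(3) D_tangent[OF v(1) a(1)] by (simp add: dir_def inner_add_left)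
  finally have "\<omega> \<bullet> v = sin \<delta> * (v \<bullet> D p a)" using cos_pos by simp
  moreover have "D p v \<bullet> a = v \<bullet> D p a" by (rule D_symmetric[OF v(1,3) a(1)])
  ultimately show ?thesis using a(1) by (simp add: transport_def inner_diff_left)
qed

text \<open>The pairing of the spray with any variation vanishes, and the end point can be held fixed while
  the chord direction turns.\<close>

lemma spray_parallel:
  assumes ut: "unit_tangent p v" and X: "variation p v v (transport p v v) b l"
  shows "b = (b \<bullet> out p v) *\<^sub>R out p v"
proof -
  let ?u = "out p v" and ?q = "tip p v"
  define z where "z = b - (b \<bullet> ?u) *\<^sub>R ?u"
  note o = out_inner[OF ut] and r = reverse[OF ut]
  have bn: "n ?q \<bullet> b = 0" using X unfolding variation_def by blast
  have zu: "?u \<bullet> z = 0" using o(1) by (simp add: z_def inner_diff_right inner_commute)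
  have zn: "n ?q \<bullet> z = 0" using bn o(2) by (simp add: z_def inner_diff_right)
  have "z = 0"
  proof (rule ccontr)
    assume nz: "z \<noteq> 0"
    have "unit_tangent ?q (z /\<^sub>R norm z)" using zn nz tip_in[OF ut] by (simp add: unit_tangent_def)
    moreover have "- ?u \<bullet> (z /\<^sub>R norm z) = 0" using zu by simp
    \<comment> \<open>The reversed chord is turned about its fixed foot \<open>tip p v\<close>
      towards \<open>z\<close>. Read backwards, this is a variation \<open>Y\<close> at
      \<open>p\<close> whose tip has velocity 0, so pairing it with \<open>X\<close> leaves only a
      multiple of \<open>z \<bullet> b\<close>.\<close>
    ultimately obtain b' l' where "variation ?q (- ?u) 0 (cos \<delta> *\<^sub>R (z /\<^sub>R norm z)) b' l'"
      using vertical_variation[OF r(1)] by blast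
    from variation_reverse[OF ut this]
    have Y: "variation p v b' (- (cos \<delta> *\<^sub>R (z /\<^sub>R norm z))) 0 l'" .
    have "(z /\<^sub>R norm z) \<bullet> b = 0"
      using variation_antisym[OF X Y] transport_spray_inner[OF ut Y] cos_pos
      by (simp add: inner_commute)
    then have "z \<bullet> b = 0" using nz by simp
    then have "z \<bullet> z = 0" using zu by (simp add: z_def inner_diff_right inner_commute)
    then show False using nz by simp
  qed
  then show ?thesis by (simp add: z_def)
qed

text \<open>The factor \<open>\<mu>\<close>; the formula solves the constraint that the end point moves tangentially.\<close>

definition stretch :: "'a \<Rightarrow> 'a \<Rightarrow> real" where
  "stretch p v = 1 + n (tip p v) \<bullet> (v + len p v *\<^sub>R transport p v v) / (sin \<delta> * cos \<delta>)"

lemma spray_rate: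
  assumes "unit_tangent p v" "variation p v v (transport p v v) b l"
  shows "l = (stretch p v - 1) * cos \<delta>"
  using variation_length_rate[OF assms] sin_pos cos_pos by (simp add: stretch_def field_simps)

text \<open>The component of \<open>b\<close> along the chord is \<open>cos \<delta> + l\<close>
  computed from the foot, and \<open>(b \<bullet> out p v) * cos \<delta>\<close> computed from the
  tip, where \<open>b\<close> is parallel to \<open>out p v\<close>. Comparison identifies the
  factor.\<close>

lemma spray_image:
  assumes ut: "unit_tangent p v" and X: "variation p v v (transport p v v) b l"
  shows "b = stretch p v *\<^sub>R out p v"
proof -
  let ?w = "dir p v"
  have b: "b = v + l *\<^sub>R ?w + len p v *\<^sub>R transport p v v" "transport p v v \<bullet> ?w = 0"
    using X unfolding variation_def by auto
  have "b \<bullet> ?w = cos \<delta> + l"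
    unfolding b(1) using dir_inner[OF ut] b(2) by (simp add: inner_add_left inner_add_right inner_commute)
  moreover have "b \<bullet> ?w = (b \<bullet> out p v) * cos \<delta>"
    using out_inner(3)[OF ut] by (subst spray_parallel[OF ut X]) (simp add: inner_commute)
  ultimately have "(b \<bullet> out p v) * cos \<delta> = stretch p v * cos \<delta>"
    using spray_rate[OF ut X] by (simp add: algebra_simps)
  then show ?thesis using spray_parallel[OF ut X] cos_pos by simp
qed

lemma spray_identity:
  assumes "unit_tangent p v"
  shows "stretch p v *\<^sub>R out p v = v + ((stretch p v - 1) * cos \<delta>) *\<^sub>R dir p v + len p v *\<^sub>R transport p v v"
    and "variation p v v (transport p v v) (stretch p v *\<^sub>R out p v) ((stretch p v - 1) * cos \<delta>)"
proof -
  obtain b l where X: "variation p v v (transport p v v) b l"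
    using transport_variation[OF assms unit_tangentD(3)[OF assms]] by blast
  then show Y: "variation p v v (transport p v v) (stretch p v *\<^sub>R out p v) ((stretch p v - 1) * cos \<delta>)"
    using spray_image[OF assms X] spray_rate[OF assms X] by simp
  then show "stretch p v *\<^sub>R out p v = v + ((stretch p v - 1) * cos \<delta>) *\<^sub>R dir p v + len p v *\<^sub>R transport p v v"
    unfolding variation_def by blast
qed

text \<open>If the factor were 0, the spray would leave the tip at rest and
  \<open>transport p v v\<close> would be tangent there. Moving the tip in this direction and
  pairing with the spray makes its squared norm 0; then \<open>v\<close> would be
  \<open>cos \<delta> *\<^sub>R dir p v\<close>, which is not tangent at \<open>p\<close>.\<close>

lemma stretch_nonzero:
  assumes ut: "unit_tangent p v" shows "stretch p v \<noteq> 0"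
proof
  assume m0: "stretch p v = 0"
  let ?u = "out p v" and ?q = "tip p v" and ?\<omega> = "transport p v v"
  have X: "variation p v v ?\<omega> 0 (- cos \<delta>)" using spray_identity(2)[OF ut] m0 by simp
  have D0: "D ?q 0 = 0" using linear_0 D_linear tip_in[OF ut] by blast
  have n\<omega>: "n ?q \<bullet> ?\<omega> = 0" using X D0 unfolding variation_def by simp
  obtain b' l' where "variation ?q (- ?u) ?\<omega> (transport ?q (- ?u) ?\<omega>) b' l'"
    using transport_variation[OF reverse(1)[OF ut] n\<omega>] by blast
  from variation_reverse[OF ut this]
  have Y: "variation p v b' (- transport ?q (- ?u) ?\<omega>) ?\<omega> l'" .
  have "?\<omega> \<bullet> ?\<omega> = 0"
    using variation_antisym[OF X Y] transport_spray_inner[OF ut Y] by (simp add: inner_commute)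
  then have "?\<omega> = 0" by simp
  then have "v = cos \<delta> *\<^sub>R dir p v" using spray_identity(1)[OF ut] m0 by simp
  then have "n p \<bullet> v = cos \<delta> * (n p \<bullet> dir p v)" by (metis inner_scaleR_right)
  then show False using dir_inner(2)[OF ut] unit_tangentD[OF ut] sin_pos cos_pos by simp
qed

section \<open>Quadratic relation and vertical derivative of the length\<close>

lemma transport_inner:
  assumes "unit_tangent p v" "n p \<bullet> a = 0"
  shows "transport p v v \<bullet> a = sin \<delta> * (D p v \<bullet> a)"
    and "transport p v v \<bullet> transport p v v
      = sin \<delta> * sin \<delta> * (D p v \<bullet> D p v) + cos \<delta> * cos \<delta> * (v \<bullet> D p v) * (v \<bullet> D p v)"
proof -
  note v = unit_tangentD[OF assms(1)]
  have nD: "n p \<bullet> D p v = 0" "D p v \<bullet> n p = 0"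
    using D_tangent[OF v(1,3)] by (simp_all add: inner_commute)
  show "transport p v v \<bullet> a = sin \<delta> * (D p v \<bullet> a)"
    using assms(2) by (simp add: transport_def inner_diff_left)
  show "transport p v v \<bullet> transport p v v
      = sin \<delta> * sin \<delta> * (D p v \<bullet> D p v) + cos \<delta> * cos \<delta> * (v \<bullet> D p v) * (v \<bullet> D p v)"
    using v nD by (simp add: transport_def inner_diff_left inner_diff_right algebra_simps)
qed

text \<open>The squared norm of \<open>transport p v v\<close> for a unit tangent vector
  \<open>v\<close>, in a form that is visibly even in \<open>v\<close>.\<close>

definition quad :: "'a \<Rightarrow> 'a \<Rightarrow> real" where
  "quad p v = sin \<delta> * sin \<delta> * (D p v \<bullet> D p v) + cos \<delta> * cos \<delta> * (v \<bullet> D p v) * (v \<bullet> D p v)"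

text \<open>Removing the components along the chord from \<open>spray_identity\<close> leaves
  \<open>out p v - cos \<delta> *\<^sub>R dir p v\<close> and
  \<open>v - cos \<delta> *\<^sub>R dir p v\<close>, both of length \<open>sin \<delta>\<close>. The
  formula compares squared norms.\<close>

lemma stretch_squared:
  assumes ut: "unit_tangent p v"
  shows "(stretch p v * sin \<delta>)\<^sup>2 = (sin \<delta>)\<^sup>2 + 2 * sin \<delta> * len p v * (v \<bullet> D p v) + (len p v)\<^sup>2 * quad p v"
proof -
  let ?u = "out p v" and ?w = "dir p v" and ?\<omega> = "transport p v v"
  let ?L = "len p v" and ?m = "stretch p v"
  note d = dir_inner[OF ut] and o = out_inner[OF ut] and v = unit_tangentD[OF ut]
  have \<omega>w: "?\<omega> \<bullet> ?w = 0" using spray_identity(2)[OF ut] unfolding variation_def by blast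
  have c: "v \<bullet> ?w = cos \<delta>" "?w \<bullet> v = cos \<delta>" "?u \<bullet> ?w = cos \<delta>" "?w \<bullet> ?u = cos \<delta>" "?w \<bullet> ?\<omega> = 0"
      "v \<bullet> ?\<omega> = ?\<omega> \<bullet> v"
    using d o \<omega>w by (simp_all add: inner_commute)
  have eq: "?m *\<^sub>R (?u - cos \<delta> *\<^sub>R ?w) = (v - cos \<delta> *\<^sub>R ?w) + ?L *\<^sub>R ?\<omega>"
    using spray_identity(1)[OF ut] by (simp add: algebra_simps)
  have "(?m *\<^sub>R (?u - cos \<delta> *\<^sub>R ?w)) \<bullet> (?m *\<^sub>R (?u - cos \<delta> *\<^sub>R ?w)) = (?m)\<^sup>2 * (1 - cos \<delta> * cos \<delta>)"
    using c d(1) o(1) by (simp add: inner_diff_left inner_diff_right power2_eq_square)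
  moreover have "((v - cos \<delta> *\<^sub>R ?w) + ?L *\<^sub>R ?\<omega>) \<bullet> ((v - cos \<delta> *\<^sub>R ?w) + ?L *\<^sub>R ?\<omega>)
     = (1 - cos \<delta> * cos \<delta>) + 2 * ?L * (?\<omega> \<bullet> v) + ?L\<^sup>2 * (?\<omega> \<bullet> ?\<omega>)"
    using c d(1) v(2) \<omega>w
    by (simp add: inner_diff_left inner_diff_right inner_add_left inner_add_right power2_eq_square distrib_left)
  moreover have "1 - cos \<delta> * cos \<delta> = (sin \<delta>)\<^sup>2" using sin_cos_sq by (simp add: power2_eq_square)
  ultimately show ?thesis
    using eq transport_inner[OF ut v(3)]
    by (simp add: power_mult_distrib quad_def inner_commute mult_ac)
qed

text \<open>\<open>variation_length_rate\<close> gives \<open>l\<close> through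
  \<open>n (tip p v) \<bullet> \<eta>\<close>. As \<open>\<eta>\<close> is orthogonal to the chord,
  this is proportional to \<open>out p v \<bullet> \<eta>\<close>, and \<open>spray_identity\<close>
  paired with \<open>\<eta>\<close> evaluates \<open>stretch p v\<close> times the latter.\<close>

lemma vertical_rate:
  assumes ut: "unit_tangent p v" and \<eta>: "n p \<bullet> \<eta> = 0" "v \<bullet> \<eta> = 0"
    and Y: "variation p v 0 (cos \<delta> *\<^sub>R \<eta>) b l"
  shows "l * sin \<delta> * stretch p v = (len p v)\<^sup>2 * (cos \<delta>)\<^sup>2 * (\<eta> \<bullet> D p v)"
proof -
  let ?u = "out p v" and ?w = "dir p v" and ?q = "tip p v"
  let ?L = "len p v" and ?m = "stretch p v"
  have \<eta>w: "\<eta> \<bullet> ?w = 0" using \<eta> by (simp add: dir_def inner_add_right inner_commute)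
  have "?m * (?u \<bullet> \<eta>) = (?m *\<^sub>R ?u) \<bullet> \<eta>" by simp
  also have "\<dots> = ?L * sin \<delta> * (\<eta> \<bullet> D p v)"
    using \<eta>w \<eta>(2) transport_inner(1)[OF ut \<eta>(1)] unfolding spray_identity(1)[OF ut]
    by (simp add: inner_add_left inner_add_right inner_commute)
  finally have 1: "?m * (?u \<bullet> \<eta>) = ?L * sin \<delta> * (\<eta> \<bullet> D p v)" .
  have "0 = ?w \<bullet> \<eta>" using \<eta>w by (simp add: inner_commute)
  also have "\<dots> = cos \<delta> * (?u \<bullet> \<eta>) - sin \<delta> * (n ?q \<bullet> \<eta>)"
    by (subst out_inner(5)[OF ut]) (simp add: inner_diff_left)
  finally have 2: "sin \<delta> * (n ?q \<bullet> \<eta>) = cos \<delta> * (?u \<bullet> \<eta>)" by simp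
  have 3: "l * sin \<delta> = ?L * cos \<delta> * (n ?q \<bullet> \<eta>)"
    using variation_length_rate[OF ut Y] by simp
  have "sin \<delta> * (l * sin \<delta> * ?m) = ?L * cos \<delta> * ?m * (sin \<delta> * (n ?q \<bullet> \<eta>))"
    unfolding 3 by (simp add: algebra_simps)
  also have "\<dots> = ?L * cos \<delta> * cos \<delta> * (?m * (?u \<bullet> \<eta>))" unfolding 2 by (simp add: algebra_simps)
  also have "\<dots> = sin \<delta> * (?L\<^sup>2 * (cos \<delta>)\<^sup>2 * (\<eta> \<bullet> D p v))"
    unfolding 1 by (simp add: algebra_simps power2_eq_square)
  finally show ?thesis using sin_pos by simp
qed

section \<open>The length along a circle of directions\<close>

lemma len_circle_derivative:
  assumes "unit_tangent p v" "unit_tangent p \<eta>" "v \<bullet> \<eta> = 0"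
  defines "c \<equiv> \<lambda>t. cos t *\<^sub>R v + sin t *\<^sub>R \<eta>" and "c' \<equiv> \<lambda>t. - sin t *\<^sub>R v + cos t *\<^sub>R \<eta>"
  shows "((\<lambda>t. len p (c t)) has_real_derivative
     (len p (c t))\<^sup>2 * (cos \<delta>)\<^sup>2 * (c' t \<bullet> D p (c t)) / (sin \<delta> * stretch p (c t))) (at t)"
proof -
  have c: "unit_tangent p (c t)" "unit_tangent p (c' t)" "c t \<bullet> c' t = 0"
    "(c has_vector_derivative c' t) (at t)" for t
    unfolding c_def c'_def by (rule circle[OF assms(1-3)])+
  obtain l b where l: "((\<lambda>s. len p (c s)) has_real_derivative l) (at t)"
      "variation p (c t) 0 (cos \<delta> *\<^sub>R c' t) b l"
    using vertical_variation_of_curve[OF c(1,4)] by blast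
  have "l * sin \<delta> * stretch p (c t) = (len p (c t))\<^sup>2 * (cos \<delta>)\<^sup>2 * (c' t \<bullet> D p (c t))"
    by (rule vertical_rate[OF c(1) unit_tangentD(3)[OF c(2)] c(3) l(2)])
  then have "l = (len p (c t))\<^sup>2 * (cos \<delta>)\<^sup>2 * (c' t \<bullet> D p (c t)) / (sin \<delta> * stretch p (c t))"
    using stretch_nonzero[OF c(1), of t] sin_pos by (simp add: field_simps)
  then show ?thesis using l(1) by simp
qed

lemma D_continuous_on: "p \<in> S \<Longrightarrow> continuous_on A (D p)"
  using linear_continuous_on linear_conv_bounded_linear D_linear by blast

lemma stretch_circle_continuous:
  assumes "unit_tangent p v" "unit_tangent p \<eta>" "v \<bullet> \<eta> = 0"
  defines "c \<equiv> \<lambda>t. cos t *\<^sub>R v + sin t *\<^sub>R \<eta>"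
  shows "continuous_on UNIV (\<lambda>t. len p (c t))" "continuous_on UNIV (\<lambda>t. stretch p (c t))"
    "continuous_on UNIV (\<lambda>t. D p (c t))"
proof -
  note p = unit_tangentD(1)[OF assms(1)]
  have ut: "unit_tangent p (c t)" for t
    unfolding c_def by (rule circle[OF assms(1-3)])
  have cc: "continuous_on UNIV c" unfolding c_def by (intro continuous_intros)
  show L: "continuous_on UNIV (\<lambda>t. len p (c t))"
    using len_circle_derivative[OF assms(1-3)] unfolding c_def
    by (intro DERIV_continuous_on) (auto simp: c_def)
  show Dc: "continuous_on UNIV (\<lambda>t. D p (c t))"
    by (rule continuous_on_compose2[OF D_continuous_on[OF p] cc]) auto
  have tip: "continuous_on UNIV (\<lambda>t. tip p (c t))"
    unfolding tip_def dir_def by (intro continuous_intros L cc)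
  have ntip: "continuous_on UNIV (\<lambda>t. n (tip p (c t)))"
    by (rule continuous_on_compose2[OF n_continuous_on tip]) (use tip_in[OF ut] in auto)
  show "continuous_on UNIV (\<lambda>t. stretch p (c t))"
    unfolding stretch_def transport_def using sin_pos cos_pos by (intro continuous_intros L cc Dc ntip) auto
qed

text \<open>Dimension at least 3 leaves room beside \<open>n p\<close> and \<open>v\<close>; this
  supplies the circle through \<open>v\<close> and \<open>- v\<close>.\<close>

lemma exists_orthogonal_unit_tangent:
  assumes "unit_tangent p v"
  obtains \<eta> where "unit_tangent p \<eta>" "v \<bullet> \<eta> = 0"
proof -
  have "dim {n p, v} \<le> card {n p, v}" by (rule dim_le_card') simp
  also have "\<dots> \<le> 2" by (simp add: card_insert_if)
  also have "\<dots> < DIM('a)" using dim by simp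
  finally obtain x where x: "x \<noteq> 0" "\<And>y. y \<in> span {n p, v} \<Longrightarrow> orthogonal x y"
    using orthogonal_to_subspace_exists by blast
  have "x \<bullet> n p = 0" "x \<bullet> v = 0" using x(2) by (auto simp: orthogonal_def span_base)
  then have "unit_tangent p (x /\<^sub>R norm x)" "v \<bullet> (x /\<^sub>R norm x) = 0"
    using x(1) unit_tangentD(1)[OF assms] by (auto simp: unit_tangent_def inner_commute)
  then show ?thesis by (rule that)
qed

lemma quad_minus: "p \<in> S \<Longrightarrow> quad p (- v) = quad p v"
  using linear_neg[OF D_linear] by (simp add: quad_def)

text \<open>On a great circle of directions the length satisfies a scalar first-order equation whose
  coefficients are invariant under the antipodal map. The difference of the lengths in opposite
  directions is odd, so it vanishes somewhere, and hence everywhere by uniqueness.\<close>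

lemma len_minus:
  assumes v: "unit_tangent p v" shows "len p (- v) = len p v"
proof -
  obtain \<eta> where \<eta>: "unit_tangent p \<eta>" "v \<bullet> \<eta> = 0"
    using exists_orthogonal_unit_tangent[OF v] by blast
  note p = unit_tangentD(1)[OF v]
  define c where "c = (\<lambda>t. cos t *\<^sub>R v + sin t *\<^sub>R \<eta>)"
  define c' where "c' = (\<lambda>t. - sin t *\<^sub>R v + cos t *\<^sub>R \<eta>)"
  define L where "L = (\<lambda>t. len p (c t))"
  define m where "m = (\<lambda>t. sin \<delta> * stretch p (c t))"
  define M where "M = (\<lambda>t. L (t + pi))"
  define m2 where "m2 = (\<lambda>t. m (t + pi))"
  define h where "h = (\<lambda>t. (cos \<delta>)\<^sup>2 * (c' t \<bullet> D p (c t)))"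
  define k where "k = (\<lambda>t. c t \<bullet> D p (c t))"
  define B where "B = (\<lambda>t. quad p (c t))"
  have ut: "unit_tangent p (c t)" for t unfolding c_def by (rule circle[OF v \<eta>])
  have shift: "c (t + pi) = - c t" "c' (t + pi) = - c' t" for t by (simp_all add: c_def c'_def)
  have Dneg: "D p (- x) = - D p x" for x by (rule linear_neg[OF D_linear[OF p]])
  have even: "h (t + pi) = h t" "k (t + pi) = k t" "B (t + pi) = B t" for t
    by (simp_all add: h_def k_def B_def shift Dneg quad_minus[OF p])
  have L': "(L has_real_derivative h t * (L t)\<^sup>2 / m t) (at t)" for t
    using len_circle_derivative[OF v \<eta>, of t] unfolding L_def h_def m_def c_def c'_def
    by (simp add: mult_ac)
  have M': "(M has_real_derivative h t * (M t)\<^sup>2 / m2 t) (at t)" for t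
    using L'[of "t + pi"] unfolding M_def m2_def DERIV_shift even .
  have msq: "(m t)\<^sup>2 = (sin \<delta>)\<^sup>2 + 2 * sin \<delta> * L t * k t + (L t)\<^sup>2 * B t" for t
    using stretch_squared[OF ut] unfolding m_def L_def k_def B_def by (simp add: mult_ac)
  have m2sq: "(m2 t)\<^sup>2 = (sin \<delta>)\<^sup>2 + 2 * sin \<delta> * M t * k t + (M t)\<^sup>2 * B t" for t
    using msq[of "t + pi"] unfolding m2_def M_def even .
  have cont_shift: "continuous_on UNIV (\<lambda>t. f (t + pi))" if "continuous_on UNIV f" for f :: "real \<Rightarrow> real"
    by (rule continuous_on_compose2[OF that]) (auto intro: continuous_intros)
  have cont: "continuous_on UNIV (\<lambda>t. len p (c t))" "continuous_on UNIV (\<lambda>t. stretch p (c t))"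
    "continuous_on UNIV (\<lambda>t. D p (c t))"
    unfolding c_def by (rule stretch_circle_continuous[OF v \<eta>])+
  have Lc: "continuous_on UNIV L" and mc: "continuous_on UNIV m"
    using cont unfolding L_def m_def by (auto intro!: continuous_intros)
  have Mc: "continuous_on UNIV M" and m2c: "continuous_on UNIV m2"
    unfolding M_def m2_def by (intro cont_shift Lc mc)+
  have cc: "continuous_on UNIV c" "continuous_on UNIV c'"
    unfolding c_def c'_def by (intro continuous_intros)+
  have kc: "continuous_on UNIV k" "continuous_on UNIV h" "continuous_on UNIV B"
    unfolding k_def h_def B_def quad_def by (intro continuous_intros cont cc)+
  have m0: "m t \<noteq> 0" for t unfolding m_def using stretch_nonzero[OF ut] sin_pos by auto
  \<comment> \<open>Both factors are values of one continuous function without zeros. Equal signs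
    make \<open>m2 + m\<close> nonzero, so \<open>m2 - m\<close> can be recovered from the
    difference of the squares.\<close>
  have mm: "m t * m2 t > 0" for t
    unfolding m2_def by (rule continuous_nonzero_same_sign[OF mc m0])
  have ms0: "m2 t + m t \<noteq> 0" and m20: "m2 t \<noteq> 0" for t
    using mm[of t] by (auto simp: zero_less_mult_iff)
  define d where "d = (\<lambda>t. L t - M t)"
  \<comment> \<open>\<open>g\<close> is what remains of the difference of the two right-hand sides
    when \<open>d\<close> is factored out, after \<open>msq\<close> and \<open>m2sq\<close> have
    made \<open>m2 - m\<close> a multiple of \<open>d\<close>.\<close>
  define g where "g = (\<lambda>t. h t * ((L t + M t) * m2 t
     - (M t)\<^sup>2 * (2 * sin \<delta> * k t + (L t + M t) * B t) / (m2 t + m t)) / (m t * m2 t))"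
  have "(d has_real_derivative g t * d t) (at t)" for t
  proof -
    have "(m2 t - m t) * (m2 t + m t) = (m2 t)\<^sup>2 - (m t)\<^sup>2" by (simp add: algebra_simps power2_eq_square)
    also have "\<dots> = - (2 * sin \<delta> * k t + (L t + M t) * B t) * d t"
      unfolding msq m2sq d_def by (simp add: algebra_simps power2_eq_square)
    finally have 1: "m2 t - m t = - (2 * sin \<delta> * k t + (L t + M t) * B t) * d t / (m2 t + m t)"
      using ms0[of t] by (simp add: eq_divide_eq)
    have "h t * (L t)\<^sup>2 / m t - h t * (M t)\<^sup>2 / m2 t
        = h t * ((L t + M t) * m2 t * d t + (M t)\<^sup>2 * (m2 t - m t)) / (m t * m2 t)"
      using m0[of t] m20[of t] by (simp add: d_def divide_simps) (simp add: algebra_simps power2_eq_square)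
    also have "\<dots> = g t * d t"
    proof -
      have "A * e + X * (- Q * e / s) = (A - X * Q / s) * e" for A e X Q s :: real
        by (simp add: algebra_simps)
      note alg = this
      show ?thesis unfolding 1 g_def alg by simp
    qed
    finally show ?thesis using DERIV_diff[OF L'[of t] M'[of t]] unfolding d_def by simp
  qed
  moreover have "continuous_on UNIV g"
    unfolding g_def using ms0 m0 m20 by (intro continuous_intros Lc Mc mc m2c kc) auto
  moreover obtain t0 where "d t0 = 0"
  proof -
    have "c (pi + pi) = c 0" using shift(1)[of pi] shift(1)[of 0] by simp
    then have "M pi = L 0" unfolding M_def L_def by (rule arg_cong)
    moreover have "M 0 = L pi" by (simp add: M_def)
    ultimately have "d pi = - d 0" by (simp add: d_def)
    moreover have "continuous_on UNIV d" unfolding d_def by (intro continuous_intros Lc Mc)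
    ultimately have "0 \<in> range d"
      using continuous_nonzero_same_sign[of d 0 pi] by (force simp: mult_less_0_iff not_less[symmetric])
    then show ?thesis using that by auto
  qed
  ultimately have "d 0 = 0" by (rule linear_ode_eq_zero)
  moreover have "c 0 = v" "c pi = - v" by (simp_all add: c_def)
  ultimately show ?thesis by (simp add: d_def M_def L_def)
qed

section \<open>The stretch factor\<close>

lemma stretch_eq_1:
  assumes v: "unit_tangent p v" shows "stretch p v = 1"
proof -
  note p = unit_tangentD(1,3)[OF v]
  have mv: "unit_tangent p (- v)" using v by simp
  obtain P where P: "\<And>t::real. P t \<in> S" "P 0 = p" "(P has_vector_derivative v) (at 0)"
    using curve_with_velocity[OF p] by blast
  obtain V l b where V: "V 0 = v" "\<And>t. unit_tangent (P t) (V t)"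
    "((\<lambda>s. len (P s) (V s)) has_real_derivative l) (at 0)"
    "variation p v v (transport p v v) b l"
    "(V has_vector_derivative - (v \<bullet> D p v) *\<^sub>R n p) (at 0)"
    by (rule transport_variation_of_curve[OF P(1,3), unfolded P(2), OF v]) (rule that)
  have V': "((\<lambda>t. - V t) has_vector_derivative - (- (v \<bullet> D p v) *\<^sub>R n p)) (at 0)"
    by (rule has_vector_derivative_minus[OF V(5)])
  have utm: "unit_tangent (P t) (- V t)" for t using V(2) by simp
  obtain l' b' where l': "((\<lambda>s. len (P s) (- V s)) has_real_derivative l') (at 0)"
    "variation p (- v) v (cos \<delta> *\<^sub>R - (- (v \<bullet> D p v) *\<^sub>R n p) + sin \<delta> *\<^sub>R D p v) b' l'"
    using variation_of_curve[OF utm P(3) V'] unfolding P(2) V(1) by blast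
  have eq: "l' = l"
    by (rule DERIV_unique[OF l'(1)[unfolded len_minus[OF V(2)]] V(3)])
  \<comment> \<open>The field \<open>- V\<close> carried along \<open>v\<close> is the spray of
    \<open>- v\<close> run backwards, which puts the minus sign before
    \<open>stretch p (- v) - 1\<close>.\<close>
  have tr: "cos \<delta> *\<^sub>R - (- (v \<bullet> D p v) *\<^sub>R n p) + sin \<delta> *\<^sub>R D p v = - transport p (- v) (- v)"
    using linear_neg[OF D_linear[OF p(1)]] by (simp add: transport_def)
  have "l' * sin \<delta> = n (tip p (- v)) \<bullet> (v + len p (- v) *\<^sub>R - transport p (- v) (- v))"
    using variation_length_rate[OF mv l'(2)] unfolding tr .
  also have "\<dots> = - (n (tip p (- v)) \<bullet> (- v + len p (- v) *\<^sub>R transport p (- v) (- v)))"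
    by (simp add: inner_add_right inner_diff_right)
  finally have l'': "l' = - ((stretch p (- v) - 1) * cos \<delta>)"
    using sin_pos cos_pos by (simp add: stretch_def field_simps)
  have "l = (stretch p v - 1) * cos \<delta>" by (rule spray_rate[OF v V(4)])
  then have "(stretch p v + stretch p (- v) - 2) * cos \<delta> = 0"
    using eq l'' by (simp add: algebra_simps)
  then have sum: "stretch p v + stretch p (- v) = 2" using cos_pos by simp
  have "(stretch p v * sin \<delta>)\<^sup>2 = (stretch p (- v) * sin \<delta>)\<^sup>2"
    unfolding stretch_squared[OF v] stretch_squared[OF mv] len_minus[OF v] quad_minus[OF p(1)]
    using linear_neg[OF D_linear[OF p(1)]] by simp
  then have "(stretch p v)\<^sup>2 = (stretch p (- v))\<^sup>2" using sin_pos by (simp add: power_mult_distrib)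
  then show ?thesis using sum by (auto simp: power2_eq_iff)
qed

section \<open>Every point is umbilic\<close>

text \<open>With \<open>stretch p v = 1\<close> the constant terms of \<open>stretch_squared\<close>
  cancel and a factor \<open>len p v\<close> divides out.\<close>

lemma len_relation:
  assumes "unit_tangent p v"
  shows "len p v * quad p v = - 2 * sin \<delta> * (v \<bullet> D p v)"
proof -
  have "len p v * (len p v * quad p v) = len p v * (- 2 * sin \<delta> * (v \<bullet> D p v))"
    using stretch_squared[OF assms] stretch_eq_1[OF assms]
    by (simp add: algebra_simps power2_eq_square)
  then show ?thesis using len_pos[OF assms] by (simp only: mult_cancel_left) simp
qed

text \<open>Differentiating \<open>len_relation\<close> on a circle of directions and inserting
  \<open>len_circle_derivative\<close> gives \<open>key\<close>, a relation free of
  \<open>len\<close>. It makes \<open>X\<close> orthogonal to all tangent vectors orthogonal to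
  \<open>v\<close>, and \<open>X\<close> is orthogonal to \<open>v\<close> by symmetry; so
  \<open>X = 0\<close>, and injectivity cancels one \<open>D p\<close>.\<close>

lemma D_parallel:
  assumes v: "unit_tangent p v"
  shows "v \<bullet> D p v \<noteq> 0" and "D p v = (v \<bullet> D p v) *\<^sub>R v"
proof -
  note p = unit_tangentD[OF v]
  note lin = D_linear[OF p(1)]
  let ?k = "v \<bullet> D p v" and ?y = "D p v \<bullet> D p v"
  have Dv: "n p \<bullet> D p v = 0" by (rule D_tangent[OF p(1,3)])
  have DDv: "n p \<bullet> D p (D p v) = 0" by (rule D_tangent[OF p(1) Dv])
  have Dv0: "D p v \<noteq> 0" using D_injective[OF p(1,3)] p(2) by auto
  have key: "(\<eta> \<bullet> D p v) * ?y = ?k * (D p \<eta> \<bullet> D p v)" if \<eta>: "unit_tangent p \<eta>" "v \<bullet> \<eta> = 0" for \<eta>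
  proof -
    define c where "c = (\<lambda>t. cos t *\<^sub>R v + sin t *\<^sub>R \<eta>)"
    have c0: "c 0 = v" by (simp add: c_def)
    have ut: "unit_tangent p (c t)" for t unfolding c_def by (rule circle[OF v \<eta>])
    have c': "(c has_vector_derivative \<eta>) (at 0)"
      using circle(4)[OF v \<eta>, of 0] unfolding c_def by simp
    have Dc: "((\<lambda>t. D p (c t)) has_vector_derivative D p \<eta>) (at 0)"
      by (rule bounded_linear.has_vector_derivative[OF _ c']) (use lin linear_conv_bounded_linear in blast)
    have k': "((\<lambda>t. c t \<bullet> D p (c t)) has_real_derivative 2 * (\<eta> \<bullet> D p v)) (at 0)"
    proof -
      have "v \<bullet> D p \<eta> = \<eta> \<bullet> D p v"
        using D_symmetric[OF p(1) unit_tangentD(3)[OF \<eta>(1)] p(3)] by (simp add: inner_commute)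
      then show ?thesis using has_real_derivative_inner[OF c' Dc] c0 by simp
    qed
    have y': "((\<lambda>t. D p (c t) \<bullet> D p (c t)) has_real_derivative 2 * (D p \<eta> \<bullet> D p v)) (at 0)"
      using has_real_derivative_inner[OF Dc Dc] c0 by (simp add: inner_commute)
    have B': "((\<lambda>t. quad p (c t)) has_real_derivative
       2 * (sin \<delta>)\<^sup>2 * (D p \<eta> \<bullet> D p v) + 4 * (cos \<delta>)\<^sup>2 * ?k * (\<eta> \<bullet> D p v)) (at 0)"
      unfolding quad_def
      by (rule derivative_eq_intros k' y' refl)+ (simp add: c0 algebra_simps power2_eq_square)
    have L': "((\<lambda>t. len p (c t)) has_real_derivative
       (len p v)\<^sup>2 * (cos \<delta>)\<^sup>2 * (\<eta> \<bullet> D p v) / sin \<delta>) (at 0)"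
      using len_circle_derivative[OF v \<eta>, of 0] stretch_eq_1[OF v] unfolding c_def by simp
    let ?h = "\<eta> \<bullet> D p v" and ?z = "D p \<eta> \<bullet> D p v" and ?L = "len p v" and ?B = "quad p v"
    have "((\<lambda>t. len p (c t) * quad p (c t)) has_real_derivative
       (?L\<^sup>2 * (cos \<delta>)\<^sup>2 * ?h / sin \<delta>) * ?B + (2 * (sin \<delta>)\<^sup>2 * ?z + 4 * (cos \<delta>)\<^sup>2 * ?k * ?h) * ?L) (at 0)"
      using DERIV_mult[OF L' B'] c0 by simp
    moreover have "((\<lambda>t. len p (c t) * quad p (c t)) has_real_derivative - 2 * sin \<delta> * (2 * ?h)) (at 0)"
      unfolding len_relation[OF ut] by (intro DERIV_cmult k')
    ultimately have 1: "(?L\<^sup>2 * (cos \<delta>)\<^sup>2 * ?h / sin \<delta>) * ?B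
        + (2 * (sin \<delta>)\<^sup>2 * ?z + 4 * (cos \<delta>)\<^sup>2 * ?k * ?h) * ?L = - 2 * sin \<delta> * (2 * ?h)"
      by (rule DERIV_unique)
    have 2: "?L * ?B = - 2 * sin \<delta> * ?k" by (rule len_relation[OF v])
    have "(?L\<^sup>2 * (cos \<delta>)\<^sup>2 * ?h / sin \<delta>) * ?B = ?L * (cos \<delta>)\<^sup>2 * ?h * (?L * ?B) / sin \<delta>"
      by (simp add: power2_eq_square)
    also have "\<dots> = - 2 * ?L * (cos \<delta>)\<^sup>2 * ?h * ?k" unfolding 2 using sin_pos by simp
    finally have 3: "?L * ((sin \<delta>)\<^sup>2 * ?z + (cos \<delta>)\<^sup>2 * ?k * ?h) = - 2 * sin \<delta> * ?h"
      using 1 by (simp add: algebra_simps)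
    have B: "?B = (sin \<delta>)\<^sup>2 * ?y + (cos \<delta>)\<^sup>2 * ?k\<^sup>2"
      by (simp add: quad_def power2_eq_square)
    \<comment> \<open>Multiplying 3 by \<open>?k\<close> produces the right-hand side of 2;
      substituting its left-hand side lets \<open>?L\<close> cancel.\<close>
    have "?L * (?k * ((sin \<delta>)\<^sup>2 * ?z + (cos \<delta>)\<^sup>2 * ?k * ?h)) = ?h * (- 2 * sin \<delta> * ?k)"
      using arg_cong[OF 3, of "\<lambda>x. ?k * x"] by (simp add: algebra_simps)
    also have "\<dots> = ?L * (?h * ?B)" unfolding 2[symmetric] by simp
    finally have "?k * ((sin \<delta>)\<^sup>2 * ?z + (cos \<delta>)\<^sup>2 * ?k * ?h) = ?h * ?B"
      using len_pos[OF v] by simp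
    then have "(sin \<delta>)\<^sup>2 * (?h * ?y) = (sin \<delta>)\<^sup>2 * (?k * ?z)"
      unfolding B by (auto simp: algebra_simps power2_eq_square)
    then show ?thesis using sin_pos by simp
  qed
  define X where "X = ?k *\<^sub>R D p (D p v) - ?y *\<^sub>R D p v"
  have Xn: "n p \<bullet> X = 0" using Dv DDv by (simp add: X_def inner_diff_right)
  have D2: "D p (D p v) \<bullet> a = D p a \<bullet> D p v" if "n p \<bullet> a = 0" for a
    using D_symmetric[OF p(1) Dv that] by (simp add: inner_commute)
  have Xv: "v \<bullet> X = 0" using D2[OF p(3)] by (simp add: X_def inner_diff_right inner_commute)
  have "X = 0"
  proof (rule ccontr)
    assume nz: "X \<noteq> 0"
    have "unit_tangent p (X /\<^sub>R norm X)" "v \<bullet> (X /\<^sub>R norm X) = 0"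
      using Xn Xv nz p(1) by (simp_all add: unit_tangent_def)
    from key[OF this] have "(X \<bullet> D p v) * ?y = ?k * (D p X \<bullet> D p v)"
      using nz linear_scale[OF lin] by (simp add: field_simps)
    then have "X \<bullet> X = 0"
      using D2[OF Xn] by (simp add: X_def inner_diff_left inner_diff_right inner_commute algebra_simps)
    then show False using nz by simp
  qed
  then have X0: "D p (?k *\<^sub>R D p v - ?y *\<^sub>R v) = 0"
    by (simp add: X_def linear_diff[OF lin] linear_scale[OF lin])
  have "n p \<bullet> (?k *\<^sub>R D p v - ?y *\<^sub>R v) = 0" using Dv p(3) by (simp add: inner_diff_right)
  then have par: "?k *\<^sub>R D p v = ?y *\<^sub>R v" using D_injective[OF p(1) _ X0] by simp
  show k0: "?k \<noteq> 0"
  proof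
    assume "?k = 0"
    then have "?y *\<^sub>R v = 0" using par by simp
    then show False using Dv0 p(2) by auto
  qed
  have "?k * ?k = ?y" using arg_cong[OF par, of "\<lambda>x. v \<bullet> x"] p(2) by simp
  then have "?k *\<^sub>R D p v = ?k *\<^sub>R (?k *\<^sub>R v)" using par by simp
  then show "D p v = ?k *\<^sub>R v" using k0 by (simp only: scaleR_cancel_left) simp
qed

text \<open>Now \<open>quad p v\<close> collapses to the square of \<open>v \<bullet> D p v\<close>.
  What remains of \<open>len_relation\<close> is the relation between the radius of a circle and a
  chord meeting it at the angle \<open>\<delta>\<close>.\<close>

lemma len_curvature:
  assumes v: "unit_tangent p v" shows "D p v = - (2 * sin \<delta> / len p v) *\<^sub>R v"
proof -
  let ?k = "v \<bullet> D p v"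
  have "D p v \<bullet> D p v = ?k * ?k"
    using arg_cong[OF D_parallel(2)[OF v], of "\<lambda>x. x \<bullet> D p v"] by simp
  then have "quad p v = (sin \<delta> * sin \<delta> + cos \<delta> * cos \<delta>) * (?k * ?k)"
    unfolding quad_def by (simp only: distrib_right mult.assoc)
  then have "quad p v = ?k * ?k" by (simp add: sin_cos_sq)
  then have "(len p v * ?k) * ?k = (- 2 * sin \<delta>) * ?k" using len_relation[OF v] by simp
  then have "len p v * ?k = - 2 * sin \<delta>" using D_parallel(1)[OF v] by (simp only: mult_cancel_right) simp
  then have "?k = - (2 * sin \<delta> / len p v)" using len_pos[OF v] by (simp add: field_simps)
  then show ?thesis using D_parallel(2)[OF v] by simp
qed

text \<open>Eigenvectors of a symmetric map that are not orthogonal share their eigenvalue, here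
  \<open>- (2 * sin \<delta> / len p v)\<close>. Orthogonal directions are compared through their
  bisector.\<close>

lemma len_direction_independent:
  assumes v: "unit_tangent p v" and v': "unit_tangent p v'" shows "len p v = len p v'"
proof -
  note p = unit_tangentD(1)[OF v]
  have *: "len p x = len p y" if "unit_tangent p x" "unit_tangent p y" "x \<bullet> y \<noteq> 0" for x y
  proof -
    have "D p x \<bullet> y = x \<bullet> D p y"
      by (rule D_symmetric[OF p unit_tangentD(3)[OF that(1)] unit_tangentD(3)[OF that(2)]])
    then have "2 * sin \<delta> / len p x = 2 * sin \<delta> / len p y"
      unfolding len_curvature[OF that(1)] len_curvature[OF that(2)] using that(3) by simp
    then show ?thesis using sin_pos len_pos[OF that(1)] len_pos[OF that(2)] by (simp add: field_simps)
  qed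
  show ?thesis
  proof (cases "v \<bullet> v' = 0")
    case False
    then show ?thesis using *[OF v v'] by simp
  next
    case True
    let ?x = "cos (pi / 4) *\<^sub>R v + sin (pi / 4) *\<^sub>R v'"
    have x: "unit_tangent p ?x" by (rule circle(1)[OF v v' True])
    have "v' \<bullet> v = 0" using True by (simp add: inner_commute)
    then have "v \<bullet> ?x \<noteq> 0" "?x \<bullet> v' \<noteq> 0"
      using True unit_tangentD(2)[OF v] unit_tangentD(2)[OF v']
      by (simp_all add: inner_add_left inner_add_right cos_45 sin_45)
    then show ?thesis using *[OF v x] *[OF x v'] by simp
  qed
qed

section \<open>The fixed centre and the sphere\<close>

text \<open>A chord at angle \<open>\<delta>\<close> in a circle of radius \<open>r\<close> has
  length \<open>2 * r * sin \<delta>\<close>. The choice of direction is immaterial by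
  \<open>len_direction_independent\<close>.\<close>

definition radius :: "'a \<Rightarrow> real" where
  "radius p = len p (SOME v. unit_tangent p v) / (2 * sin \<delta>)"

lemma radius_eq:
  assumes "unit_tangent p v" shows "radius p = len p v / (2 * sin \<delta>)"
proof -
  have "unit_tangent p (SOME v. unit_tangent p v)" using assms by (rule someI)
  from len_direction_independent[OF this assms] show ?thesis by (simp only: radius_def)
qed

lemma radius_pos:
  assumes "p \<in> S" shows "radius p > 0"
proof -
  obtain v where v: "unit_tangent p v" using exists_unit_tangent[OF assms] .
  show ?thesis unfolding radius_eq[OF v] using len_pos[OF v] sin_pos by simp
qed

lemma tangent_decompose:
  assumes "p \<in> S" "n p \<bullet> a = 0"
  obtains v \<alpha> where "unit_tangent p v" "a = \<alpha> *\<^sub>R v"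
proof (cases "a = 0")
  case True
  then show ?thesis using exists_unit_tangent[OF assms(1)] that[of _ 0] by auto
next
  case False
  then show ?thesis using that[of "a /\<^sub>R norm a" "norm a"] assms by (simp add: unit_tangent_def)
qed

lemma D_umbilic:
  assumes "p \<in> S" "n p \<bullet> a = 0" shows "D p a = - (1 / radius p) *\<^sub>R a"
proof -
  obtain v \<alpha> where v: "unit_tangent p v" "a = \<alpha> *\<^sub>R v" using tangent_decompose[OF assms] by blast
  show ?thesis unfolding v(2) linear_scale[OF D_linear[OF assms(1)]] len_curvature[OF v(1)] radius_eq[OF v(1)]
    by simp
qed

text \<open>The velocity is a multiple of a unit tangent vector \<open>v\<close>. By linearity the
  carried chord changes its length at that multiple of the spray rate, which is 0 since
  \<open>stretch\<close> is 1.\<close>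

lemma radius_derivative:
  assumes P: "\<And>t. P t \<in> S" "(P has_vector_derivative a) (at t0)"
  shows "((\<lambda>t. radius (P t)) has_real_derivative 0) (at t0)"
proof -
  let ?p = "P t0"
  have na: "n ?p \<bullet> a = 0" by (rule tangent_velocity[OF P])
  obtain v \<alpha> where v: "unit_tangent ?p v" "a = \<alpha> *\<^sub>R v" using tangent_decompose[OF P(1) na] by blast
  obtain V l b where V: "V t0 = v" "\<And>t. unit_tangent (P t) (V t)"
    "((\<lambda>s. len (P s) (V s)) has_real_derivative l) (at t0)"
    "variation ?p v a (transport ?p v a) b l"
    by (rule transport_variation_of_curve[OF P v(1)]) (rule that)
  have tr: "transport ?p v a = \<alpha> *\<^sub>R transport ?p v v"
    unfolding transport_def v(2) linear_scale[OF D_linear[OF P(1)]] by (simp add: algebra_simps)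
  have 0: "n (tip ?p v) \<bullet> (v + len ?p v *\<^sub>R transport ?p v v) = 0"
    using stretch_eq_1[OF v(1)] sin_pos cos_pos unfolding stretch_def by simp
  have "l * sin \<delta> = n (tip ?p v) \<bullet> (\<alpha> *\<^sub>R (v + len ?p v *\<^sub>R transport ?p v v))"
    unfolding variation_length_rate[OF v(1) V(4)] tr unfolding v(2) by (simp add: algebra_simps)
  then have "l = 0" using 0 sin_pos by simp
  then show ?thesis using DERIV_cdivide[OF V(3), of "2 * sin \<delta>"] unfolding radius_eq[OF V(2)] by simp
qed

text \<open>The two points are joined by the radial projection of the line through them. Along this
  boundary curve the radius is constant, and the candidate centre \<open>F\<close> has velocity 0 by
  \<open>D_umbilic\<close>.\<close>

lemma centre_unique:
  assumes "p \<in> S" "q \<in> S"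
  shows "radius p = radius q \<and> p + radius p *\<^sub>R n p = q + radius q *\<^sub>R n q"
proof -
  \<comment> \<open>The affine hull of two points has empty interior in this dimension, so the
    projection can start from an interior point of \<open>K\<close> off the line.\<close>
  have "interior (affine hull {p, q}) = {}"
    by (rule empty_interior_affine_hull) (use dim in \<open>auto simp: card_insert_if\<close>)
  then have "\<not> interior K \<subseteq> affine hull {p, q}"
    using interior_K interior_maximal[OF _ open_interior] by (metis subset_empty)
  then obtain o' where o: "o' \<in> interior K" "o' \<notin> affine hull {p, q}" by blast
  define c where "c = (\<lambda>t. p + t *\<^sub>R (q - p))"
  have ne: "c t \<noteq> o'" for t
  proof -
    have "c t = (1 - t) *\<^sub>R p + t *\<^sub>R q" by (simp add: c_def algebra_simps)
    then have "c t \<in> affine hull {p, q}" by (force simp: affine_hull_2)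
    then show ?thesis using o(2) by auto
  qed
  have d: "(c has_vector_derivative (q - p)) (at t)" for t
    unfolding c_def by (auto intro!: derivative_eq_intros)
  define P where "P = (\<lambda>t. o' + exit_time o' (c t - o') *\<^sub>R (c t - o'))"
  note bc = boundary_curve[OF o(1) ne d, folded P_def]
  have PS: "P t \<in> S" for t unfolding P_def by (rule bc(1)[unfolded P_def])
  have ends: "P 0 = p" "P 1 = q" using bc(3)[of 0] bc(3)[of 1] assms unfolding P_def by (auto simp: c_def)
  have "\<exists>a. (P has_vector_derivative a) (at t)" for t using bc(2)[of t] unfolding P_def by blast
  then obtain a where a: "\<And>t. (P has_vector_derivative a t) (at t)" by metis
  have "radius (P 0) = radius (P 1)" by (rule DERIV_isconst_all) (rule allI, rule radius_derivative[OF PS a])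
  moreover define F where "F = (\<lambda>t. P t + radius (P t) *\<^sub>R n (P t))"
  have "(F has_derivative (\<lambda>h. 0)) (at t within UNIV)" for t
  proof -
    have "(F has_vector_derivative
        a t + (radius (P t) *\<^sub>R D (P t) (a t) + 0 *\<^sub>R n (P t))) (at t)"
      unfolding F_def by (intro has_vector_derivative_add a has_vector_derivative_scaleR
        radius_derivative[OF PS a] n_along[OF PS a])
    then show ?thesis
      using D_umbilic[OF PS tangent_velocity[OF PS a], of t] radius_pos[OF PS, of t]
      by (simp add: has_vector_derivative_def)
  qed
  then have "F 0 = F 1" by (intro has_derivative_zero_unique[of UNIV F]) auto
  ultimately show ?thesis using ends by (simp add: F_def)
qed

text \<open>By \<open>centre_unique\<close> the boundary lies on a sphere, so \<open>K\<close>, the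
  convex hull of its boundary, lies in the ball. A point \<open>y\<close> of the sphere outside
  \<open>S\<close> would be outside \<open>K\<close>; the segment from an interior point to
  \<open>y\<close> would then meet \<open>S\<close> inside the open ball.\<close>

lemma frontier_eq_sphere: "\<exists>c r. r > 0 \<and> S = sphere c r"
proof -
  have "S \<noteq> {}" using interior_K compact_imp_bounded[OF compact_K] not_bounded_UNIV
    by (auto simp: frontier_eq_empty)
  then obtain p where p: "p \<in> S" by blast
  define c where "c = p + radius p *\<^sub>R n p"
  define r where "r = radius p"
  have r: "r > 0" using radius_pos[OF p] by (simp add: r_def)
  have sub: "S \<subseteq> sphere c r"
  proof
    fix q assume q: "q \<in> S"
    then have "c = q + r *\<^sub>R n q" using centre_unique[OF p q] unfolding c_def r_def by metis
    then show "q \<in> sphere c r" using r norm_n[OF q] by (simp add: dist_norm)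
  qed
  have K_sub: "K \<subseteq> cball c r"
  proof -
    have "K = convex hull S"
      using Krein_Milman_frontier[OF convex_K compact_K] .
    also have "\<dots> \<subseteq> cball c r" by (rule hull_minimal) (use sub in auto)
    finally show ?thesis .
  qed
  obtain o' where o: "o' \<in> interior K" using interior_K by blast
  have ob: "o' \<in> ball c r" using interior_mono[OF K_sub] o by (metis interior_cball subsetD)
  have "y \<in> S" if y: "y \<in> sphere c r" for y
  proof (rule ccontr)
    assume yS: "y \<notin> S"
    have "y \<notin> ball c r" using y by simp
    then have "y \<notin> interior K" using interior_mono[OF K_sub] by (metis interior_cball subsetD)
    then have yK: "y \<notin> K" using yS K_minus_interior by blast
    have "closed_segment o' y \<inter> S \<noteq> {}"
      proof (rule connected_Int_frontier)
      show "closed_segment o' y \<inter> K \<noteq> {}" using o interior_subset by (metis disjoint_iff ends_in_segment(1) subsetD)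
      show "closed_segment o' y - K \<noteq> {}" using yK by auto
    qed simp
    then obtain x where x: "x \<in> closed_segment o' y" "x \<in> S" by blast
    have "x \<noteq> o'" using x(2) o K_minus_interior by auto
    moreover have "x \<noteq> y" using x(2) yS by auto
    ultimately have "x \<in> open_segment o' y" using x(1) by (simp add: open_segment_def)
    then have "dist c x < r"
      using dist_decreases_open_segment[of x o' y c] ob y by (simp only: mem_ball mem_sphere) argo
    moreover have "x \<in> sphere c r" using sub x(2) by (rule subsetD)
    ultimately show False by simp
  qed
  then show ?thesis using sub r by blast
qed

end

section \<open>Smooth hypersurfaces bounding convex bodies\<close>

lemma DERIV_along_line:
  assumes "(f has_derivative f') (at p)"
  shows "((\<lambda>t. f (p + t *\<^sub>R u)) has_real_derivative f' u) (at 0)"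
proof -
  have "((\<lambda>t. p + t *\<^sub>R u) has_vector_derivative u) (at 0)" by (auto intro!: derivative_eq_intros)
  then show ?thesis
    using vector_derivative_diff_chain_within[of "\<lambda>t. p + t *\<^sub>R u" u 0 UNIV f f']
      has_derivative_at_withinI[OF assms]
    by (simp add: o_def has_real_derivative_iff_has_vector_derivative)
qed

text \<open>The mean value theorem is applied twice: in direction \<open>a\<close> to the difference
  \<open>\<phi>\<close> of two parallel lines, then in direction \<open>b\<close> to
  \<open>fa\<close>. The quotient is thus exactly a value of \<open>fab\<close> at a point tending
  to \<open>p\<close>.\<close>

lemma second_difference_tendsto:
  fixes f :: "'a::euclidean_space \<Rightarrow> real" and fa :: "'a \<Rightarrow> real"
  assumes U: "open U" "p \<in> U"
    and fa: "\<And>x. x \<in> U \<Longrightarrow> ((\<lambda>t. f (x + t *\<^sub>R a)) has_real_derivative fa x) (at 0)"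
    and fab: "\<And>x. x \<in> U \<Longrightarrow> ((\<lambda>t. fa (x + t *\<^sub>R b)) has_real_derivative fab x) (at 0)"
    and cont: "isCont fab p"
  shows "((\<lambda>h. (f (p + h *\<^sub>R a + h *\<^sub>R b) - f (p + h *\<^sub>R a) - f (p + h *\<^sub>R b) + f p) / h\<^sup>2)
     \<longlongrightarrow> fab p) (at_right 0)"
proof (rule tendstoI)
  fix \<epsilon> :: real assume "\<epsilon> > 0"
  then obtain d1 where d1: "d1 > 0" "\<And>x. dist x p < d1 \<Longrightarrow> dist (fab x) (fab p) < \<epsilon>"
    using cont unfolding continuous_at_eps_delta by metis
  obtain d2 where d2: "d2 > 0" "ball p d2 \<subseteq> U" using U open_contains_ball by blast
  have ab1: "norm a + norm b + 1 > 0" using norm_ge_zero[of a] norm_ge_zero[of b] by linarith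
  \<comment> \<open>For \<open>h < d\<close> the whole parallelogram with sides
    \<open>h *\<^sub>R a\<close> and \<open>h *\<^sub>R b\<close> lies in \<open>U\<close> and
    within \<open>d1\<close> of \<open>p\<close>.\<close>
  define d where "d = min d1 d2 / (norm a + norm b + 1)"
  have dpos: "d > 0" unfolding d_def using d1(1) d2(1) ab1 by simp
  have small: "norm (s *\<^sub>R a + t *\<^sub>R b) < min d1 d2" if "0 \<le> s" "s \<le> h" "0 \<le> t" "t \<le> h" "h < d" for s t h
  proof -
    have "norm (s *\<^sub>R a + t *\<^sub>R b) \<le> s * norm a + t * norm b"
      using norm_triangle_ineq[of "s *\<^sub>R a" "t *\<^sub>R b"] that by simp
    also have "\<dots> \<le> h * norm a + h * norm b" using that by (intro add_mono mult_right_mono) auto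
    also have "\<dots> \<le> h * (norm a + norm b + 1)" using that by (simp add: algebra_simps)
    also have "\<dots> < d * (norm a + norm b + 1)"
      using that(5) ab1 by (rule mult_strict_right_mono)
    also have "\<dots> = min d1 d2" unfolding d_def
      using ab1 by simp
    finally show ?thesis .
  qed
  have inU: "p + s *\<^sub>R a + t *\<^sub>R b \<in> U" if "0 \<le> s" "s \<le> h" "0 \<le> t" "t \<le> h" "h < d" for s t h
  proof -
    have "dist p (p + x) = norm x" for x by (simp add: dist_norm)
    from this[of "s *\<^sub>R a + t *\<^sub>R b"]
    have "dist p (p + s *\<^sub>R a + t *\<^sub>R b) = norm (s *\<^sub>R a + t *\<^sub>R b)" by (simp only: add.assoc)
    then show ?thesis using small[OF that] by (intro subsetD[OF d2(2)]) simp
  qed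
  have shift: "((\<lambda>t. g (x + t *\<^sub>R u)) has_real_derivative g') (at s)"
    if "((\<lambda>t. g ((x + s *\<^sub>R u) + t *\<^sub>R u)) has_real_derivative g') (at 0)" for g :: "'a \<Rightarrow> real" and g' x u s
  proof -
    have "(\<lambda>t. g ((x + s *\<^sub>R u) + t *\<^sub>R u)) = (\<lambda>t. (\<lambda>r. g (x + r *\<^sub>R u)) (t + s))"
      by (simp add: algebra_simps)
    then show ?thesis using that DERIV_shift[of "\<lambda>r. g (x + r *\<^sub>R u)" g' 0 s] by simp
  qed
  have "dist ((f (p + h *\<^sub>R a + h *\<^sub>R b) - f (p + h *\<^sub>R a) - f (p + h *\<^sub>R b) + f p) / h\<^sup>2) (fab p) < \<epsilon>"
    if h: "0 < h" "h < d" for h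
  proof -
    define \<phi> where "\<phi> = (\<lambda>s. f (p + h *\<^sub>R b + s *\<^sub>R a) - f (p + s *\<^sub>R a))"
    have "\<exists>s. 0 < s \<and> s < h \<and> \<phi> h - \<phi> 0 = (h - 0) * (fa (p + s *\<^sub>R a + h *\<^sub>R b) - fa (p + s *\<^sub>R a))"
    proof (rule MVT2[OF h(1)])
      fix s assume s: "0 \<le> s" "s \<le> h"
      have "((\<lambda>s. f (p + h *\<^sub>R b + s *\<^sub>R a)) has_real_derivative fa (p + s *\<^sub>R a + h *\<^sub>R b)) (at s)"
        by (rule shift[where g = f and u = a]) (use fa[OF inU[OF s _ _ h(2), of h]] h in \<open>simp add: add_ac\<close>)
      moreover have "((\<lambda>s. f (p + s *\<^sub>R a)) has_real_derivative fa (p + s *\<^sub>R a)) (at s)"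
        by (rule shift[where g = f and u = a]) (use fa[OF inU[OF s _ _ h(2), of 0]] h in simp)
      ultimately show "(\<phi> has_real_derivative fa (p + s *\<^sub>R a + h *\<^sub>R b) - fa (p + s *\<^sub>R a)) (at s)"
        unfolding \<phi>_def by (rule DERIV_diff)
    qed
    then obtain s where s: "0 < s" "s < h"
      "\<phi> h - \<phi> 0 = h * (fa (p + s *\<^sub>R a + h *\<^sub>R b) - fa (p + s *\<^sub>R a))" by auto
    have "\<exists>t. 0 < t \<and> t < h \<and> fa (p + s *\<^sub>R a + h *\<^sub>R b) - fa (p + s *\<^sub>R a + 0 *\<^sub>R b) = (h - 0) * fab (p + s *\<^sub>R a + t *\<^sub>R b)"
    proof (rule MVT2[OF h(1)])
      fix t assume t: "0 \<le> t" "t \<le> h"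
      show "((\<lambda>t. fa (p + s *\<^sub>R a + t *\<^sub>R b)) has_real_derivative fab (p + s *\<^sub>R a + t *\<^sub>R b)) (at t)"
        by (rule shift[where g = fa and u = b]) (use fab[OF inU[OF _ _ t h(2), of s]] s in simp)
    qed
    then obtain t where t: "0 < t" "t < h"
      "fa (p + s *\<^sub>R a + h *\<^sub>R b) - fa (p + s *\<^sub>R a) = h * fab (p + s *\<^sub>R a + t *\<^sub>R b)" by auto
    have "f (p + h *\<^sub>R a + h *\<^sub>R b) - f (p + h *\<^sub>R a) - f (p + h *\<^sub>R b) + f p = \<phi> h - \<phi> 0"
      by (simp add: \<phi>_def add_ac)
    then have "(f (p + h *\<^sub>R a + h *\<^sub>R b) - f (p + h *\<^sub>R a) - f (p + h *\<^sub>R b) + f p) / h\<^sup>2 = fab (p + s *\<^sub>R a + t *\<^sub>R b)"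
      using s(3) t(3) h by (simp add: power2_eq_square)
    moreover have "dist (p + s *\<^sub>R a + t *\<^sub>R b) p < d1"
      using small[of s h t] s t h by (simp add: dist_norm add.assoc)
    ultimately show ?thesis using d1(2) by simp
  qed
  then show "\<forall>\<^sub>F h in at_right 0. dist ((f (p + h *\<^sub>R a + h *\<^sub>R b) - f (p + h *\<^sub>R a) - f (p + h *\<^sub>R b) + f p) / h\<^sup>2) (fab p) < \<epsilon>"
    unfolding eventually_at_right_field using dpos by blast
qed

lemma Ck_on_has_derivative:
  assumes "Ck_on (Suc k) f U" "x \<in> U" shows "(f has_derivative frechet_derivative f (at x)) (at x)"
  using assms frechet_derivative_works by auto

text \<open>The second difference does not change when \<open>a\<close> and \<open>b\<close> are
  exchanged, so its two limits coincide.\<close>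

lemma frechet_second_derivative_symmetric:
  fixes f :: "'a::euclidean_space \<Rightarrow> real"
  assumes f: "Ck_on 2 f U" and U: "open U" "p \<in> U"
  shows "frechet_derivative (\<lambda>x. frechet_derivative f (at x) a) (at p) b
       = frechet_derivative (\<lambda>x. frechet_derivative f (at x) b) (at p) a"
proof -
  define H where "H = (\<lambda>a b x. frechet_derivative (\<lambda>y. frechet_derivative f (at y) a) (at x) b)"
  let ?\<Delta> = "\<lambda>a b h. (f (p + h *\<^sub>R a + h *\<^sub>R b) - f (p + h *\<^sub>R a) - f (p + h *\<^sub>R b) + f p) / h\<^sup>2"
  have f2: "Ck_on (Suc (Suc 0)) f U" using f by (simp add: numeral_2_eq_2)
  have f1: "Ck_on (Suc 0) (\<lambda>y. frechet_derivative f (at y) a) U" for a using f2 by simp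
  have f0: "continuous_on U (H a b)" for a b
    using f1[of a] unfolding Ck_on.simps H_def by blast
  have lim: "(?\<Delta> a b \<longlongrightarrow> H a b p) (at_right 0)" for a b
  proof (rule second_difference_tendsto[OF U])
    show "((\<lambda>t. f (x + t *\<^sub>R a)) has_real_derivative frechet_derivative f (at x) a) (at 0)" if "x \<in> U" for x
      by (rule DERIV_along_line[OF Ck_on_has_derivative[OF f2 that]])
    show "((\<lambda>t. frechet_derivative f (at (x + t *\<^sub>R b)) a) has_real_derivative H a b x) (at 0)" if "x \<in> U" for x
      unfolding H_def by (rule DERIV_along_line[OF Ck_on_has_derivative[OF f1 that]])
    show "isCont (H a b) p" using f0 U by (simp add: continuous_on_eq_continuous_at)
  qed
  have "p + h *\<^sub>R b + h *\<^sub>R a = p + h *\<^sub>R a + h *\<^sub>R b" for h :: real by simp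
  from arg_cong[OF this, of f] have "?\<Delta> b a = ?\<Delta> a b" by (simp add: fun_eq_iff)
  with lim[of b a] have "(?\<Delta> a b \<longlongrightarrow> H b a p) (at_right 0)" by simp
  from tendsto_unique[OF _ lim[of a b] this] have "H a b p = H b a p" by simp
  then show ?thesis by (simp add: H_def)
qed

section \<open>Local equations and supporting functionals\<close>

locale smooth_convex_body =
  fixes K :: "'a::euclidean_space set"
  assumes compact_K: "compact K" and convex_K: "convex K" and interior_K: "interior K \<noteq> {}"
    and smooth: "smooth_hypersurface (frontier K)"
begin

lemma frontier_subset: "frontier K \<subseteq> K"
  using compact_K by (simp add: frontier_subset_closed compact_imp_closed)

lemma local_defining_function_derivative:
  assumes "local_defining_function (frontier K) p U f" "x \<in> U"
  shows "(f has_derivative frechet_derivative f (at x)) (at x)"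
proof -
  have "smooth_on f U" using assms unfolding local_defining_function_def by blast
  then have "Ck_on (Suc 0) f U" unfolding smooth_on_def by blast
  from Ck_on_has_derivative[OF this assms(2)] show ?thesis .
qed

lemma local_defining_function_moved:
  assumes "local_defining_function (frontier K) p U f" "x \<in> U"
  shows "local_defining_function (frontier K) x U f"
  using assms unfolding local_defining_function_def by blast

lemma ex_local_defining_function:
  assumes "p \<in> frontier K" obtains U f where "local_defining_function (frontier K) p U f"
  using assms smooth unfolding smooth_hypersurface_def by blast

lemma ex_support:
  assumes "p \<in> frontier K"
  obtains a where "norm a = 1" "\<And>x. x \<in> K \<Longrightarrow> a \<bullet> (x - p) \<ge> 0"
proof -
  have "p \<in> closure K" "p \<notin> rel_interior K"
    using assms interior_K by (auto simp: frontier_def rel_interior_nonempty_interior)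
  then obtain a where a: "a \<noteq> 0" "\<And>y. y \<in> closure K \<Longrightarrow> a \<bullet> p \<le> a \<bullet> y"
    using supporting_hyperplane_relative_frontier[OF convex_K] by metis
  show ?thesis
  proof (rule that[of "a /\<^sub>R norm a"])
    show "norm (a /\<^sub>R norm a) = 1" using a by simp
    show "(a /\<^sub>R norm a) \<bullet> (x - p) \<ge> 0" if "x \<in> K" for x
    proof -
      have "x \<in> closure K" using that closure_subset by blast
      then have "a \<bullet> (x - p) \<ge> 0" using a(2) by (simp add: inner_diff_right)
      then show ?thesis by (simp add: zero_le_mult_iff)
    qed
  qed
qed

text \<open>Differentiability at \<open>p\<close> and the intermediate value theorem produce boundary points in
  directions arbitrarily close to any tangent vector, so the supporting functional vanishes on it.\<close>

lemma support_vanishes_on_kernel: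
  assumes ldf: "local_defining_function (frontier K) p U f" and p: "p \<in> frontier K"
    and a: "\<And>x. x \<in> K \<Longrightarrow> a \<bullet> (x - p) \<ge> 0"
    and v: "frechet_derivative f (at p) v = 0" and z: "frechet_derivative f (at p) z > 0"
  shows "a \<bullet> v \<ge> 0"
proof -
  let ?f' = "frechet_derivative f (at p)"
  have U: "open U" "p \<in> U" "frontier K \<inter> U = {x \<in> U. f x = 0}"
    using ldf unfolding local_defining_function_def by auto
  have f': "(f has_derivative ?f') (at p)" by (rule local_defining_function_derivative[OF ldf U(2)])
  have lin: "linear ?f'" using f' has_derivative_linear by blast
  have f0: "f p = 0" using p U by auto
  have fc: "continuous_on U f"
    using local_defining_function_derivative[OF ldf] has_derivative_continuous
    by (meson continuous_at_imp_continuous_on)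
  have main: "a \<bullet> v \<ge> - e * \<bar>a \<bullet> z\<bar>" if e: "e > 0" for e
  proof -
    \<comment> \<open>The direction is tilted by \<open>\<sigma> *\<^sub>R z\<close>. For short
      times \<open>f\<close> is positive at the tilt \<open>e\<close> and negative at
      \<open>- e\<close>, so some tilt in between ends on the boundary, where support
      applies.\<close>
    let ?y = "\<lambda>\<sigma> t. p + t *\<^sub>R (v + \<sigma> *\<^sub>R z)"
    have der: "((\<lambda>t. f (?y \<sigma> t)) has_real_derivative \<sigma> * ?f' z) (at 0)" for \<sigma>
      using DERIV_along_line[OF f', of "v + \<sigma> *\<^sub>R z"] v
      by (simp add: linear_add[OF lin] linear_scale[OF lin])
    obtain d1 where d1: "d1 > 0" "\<And>h. 0 < h \<Longrightarrow> h < d1 \<Longrightarrow> f (?y e h) > 0"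
      using DERIV_pos_inc_right[OF der[of e]] z e f0 by auto
    obtain d2 where d2: "d2 > 0" "\<And>h. 0 < h \<Longrightarrow> h < d2 \<Longrightarrow> f (?y (- e) h) < 0"
      using DERIV_neg_dec_right[OF der[of "- e"]] z e f0 by (auto simp: mult_neg_pos)
    obtain d3 where d3: "d3 > 0" "ball p d3 \<subseteq> U" using U open_contains_ball by blast
    define M where "M = norm v + e * norm z + 1"
    have M: "M > 0" unfolding M_def using e by (auto intro: add_nonneg_pos)
    \<comment> \<open>Halving makes the bounds strict; \<open>d3 / M\<close> keeps every tilted
      point inside \<open>U\<close>.\<close>
    define t where "t = min (min d1 d2) (d3 / M) / 2"
    have t0: "0 < t" using d1(1) d2(1) d3(1) M unfolding t_def by simp
    then have "t < min (min d1 d2) (d3 / M)" unfolding t_def by linarith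
    then have t: "0 < t" "t < d1" "t < d2" "t * M < d3" using t0 M by (auto simp: pos_less_divide_eq)
    have ball: "?y \<sigma> t \<in> ball p d3" if "\<bar>\<sigma>\<bar> \<le> e" for \<sigma>
    proof -
      have "norm (v + \<sigma> *\<^sub>R z) \<le> norm v + e * norm z"
        using norm_triangle_ineq[of v "\<sigma> *\<^sub>R z"] mult_right_mono[OF that norm_ge_zero[of z]] by simp
      then have "t * norm (v + \<sigma> *\<^sub>R z) \<le> t * M" using t(1) unfolding M_def by (intro mult_left_mono) auto
      then have "t * norm (v + \<sigma> *\<^sub>R z) < d3" using t(4) by linarith
      then show ?thesis using t(1) by (simp add: dist_norm)
    qed
    have cont: "continuous_on {- e..e} (\<lambda>\<sigma>. f (?y \<sigma> t))"
      by (rule continuous_on_compose2[OF fc]) (use ball d3 in \<open>auto intro!: continuous_intros simp: subset_iff\<close>)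
    have "\<exists>\<sigma>. - e \<le> \<sigma> \<and> \<sigma> \<le> e \<and> f (?y \<sigma> t) = 0"
      by (rule IVT'[of "\<lambda>\<sigma>. f (?y \<sigma> t)"]) (use d1(2)[of t] d2(2)[of t] t e cont in \<open>auto simp: less_imp_le\<close>)
    then obtain \<sigma> where \<sigma>': "- e \<le> \<sigma>" "\<sigma> \<le> e" "f (?y \<sigma> t) = 0" by blast
    then have \<sigma>: "\<bar>\<sigma>\<bar> \<le> e" "f (?y \<sigma> t) = 0" by simp_all
    have "?y \<sigma> t \<in> frontier K" using ball[OF \<sigma>(1)] d3 \<sigma>(2) U by blast
    from a[OF subsetD[OF frontier_subset this]] have "a \<bullet> v + \<sigma> * (a \<bullet> z) \<ge> 0"
      using t(1) by (simp add: inner_add_right zero_le_mult_iff)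
    moreover have "\<sigma> * (a \<bullet> z) \<le> e * \<bar>a \<bullet> z\<bar>"
      using mult_right_mono[OF \<sigma>(1), of "\<bar>a \<bullet> z\<bar>"] by (metis abs_ge_self abs_ge_zero abs_mult order_trans)
    ultimately show ?thesis by simp
  qed
  show ?thesis
  proof (rule field_le_epsilon)
    fix e :: real assume e: "e > 0"
    let ?e = "e / (\<bar>a \<bullet> z\<bar> + 1)"
    have "?e * \<bar>a \<bullet> z\<bar> \<le> e" using e by (simp add: field_simps)
    moreover have "?e > 0" using e by (intro divide_pos_pos) auto
    ultimately show "0 \<le> a \<bullet> v + e" using main[of ?e] by simp
  qed
qed

text \<open>\<open>support_vanishes_on_kernel\<close>, applied to \<open>v\<close> and
  \<open>- v\<close>, puts the kernel of the derivative into that of \<open>a\<close>. A functional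
  vanishing on the kernel of another is a multiple of it.\<close>

lemma derivative_proportional_support:
  assumes ldf: "local_defining_function (frontier K) p U f" and p: "p \<in> frontier K"
    and a: "norm a = 1" "\<And>x. x \<in> K \<Longrightarrow> a \<bullet> (x - p) \<ge> 0"
  obtains \<gamma> where "\<gamma> \<noteq> 0" "\<And>v. frechet_derivative f (at p) v = \<gamma> * (a \<bullet> v)"
proof -
  let ?f' = "frechet_derivative f (at p)"
  have U: "p \<in> U" "\<exists>v. ?f' v \<noteq> 0"
    using ldf p unfolding local_defining_function_def by auto
  have lin: "linear ?f'" using local_defining_function_derivative[OF ldf U(1)] has_derivative_linear by blast
  obtain z where z: "?f' z > 0"
  proof -
    obtain v where "?f' v \<noteq> 0" using U by blast
    then show ?thesis using that[of v] that[of "- v"] linear_neg[OF lin, of v] by (cases "?f' v > 0") auto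
  qed
  have ker: "a \<bullet> v = 0" if "?f' v = 0" for v
    using support_vanishes_on_kernel[OF ldf p a(2) that z]
      support_vanishes_on_kernel[OF ldf p a(2) _ z, of "- v"] that linear_neg[OF lin, of v] by auto
  define c where "c = (a \<bullet> z) / ?f' z"
  have eq: "a \<bullet> v = c * ?f' v" for v
  proof -
    have "?f' (v - (?f' v / ?f' z) *\<^sub>R z) = 0"
      using z by (simp add: linear_diff[OF lin] linear_scale[OF lin])
    from ker[OF this] show ?thesis by (simp add: c_def inner_diff_right)
  qed
  have "c \<noteq> 0" using eq[of a] a(1) by (auto simp: norm_eq_1)
  then show ?thesis using that[of "1 / c"] eq by (simp add: field_simps)
qed

text \<open>The direction \<open>w\<close> is compared with \<open>o' - p\<close>, which enters by
  convexity. On the segment between them \<open>a\<close> is bounded below, so for small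
  \<open>t\<close> the local equation has no zero on the scaled segment, which therefore cannot
  leave \<open>K\<close>.\<close>

lemma support_entering:
  assumes p: "p \<in> frontier K" and a: "norm a = 1" "\<And>x. x \<in> K \<Longrightarrow> a \<bullet> (x - p) \<ge> 0"
    and w: "a \<bullet> w > 0"
  shows "\<exists>e>0. \<forall>t\<in>{0<..<e}. p + t *\<^sub>R w \<in> interior K"
proof -
  obtain o' where o: "o' \<in> interior K" using interior_K by blast
  let ?w = "o' - p"
  have ao: "a \<bullet> ?w > 0" by (rule support_pos_interior[OF a o])
  obtain U f where ldf: "local_defining_function (frontier K) p U f" using ex_local_defining_function[OF p] .
  then have U: "open U" "p \<in> U" "frontier K \<inter> U = {x \<in> U. f x = 0}"
    unfolding local_defining_function_def by auto
  obtain \<gamma> where \<gamma>: "\<gamma> \<noteq> 0" "\<And>v. frechet_derivative f (at p) v = \<gamma> * (a \<bullet> v)"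
    using derivative_proportional_support[OF ldf p a] by blast
  have f0: "f p = 0" using p U by auto
  define m where "m = min (a \<bullet> w) (a \<bullet> ?w)"
  define M where "M = max (norm w) (norm ?w)"
  have m: "m > 0" using w ao by (simp add: m_def)
  have "w \<noteq> 0" using w by auto
  then have M: "M > 0" unfolding M_def by (simp add: less_max_iff_disj)
  have seg: "a \<bullet> x \<ge> m" "norm x \<le> M" if "x \<in> closed_segment w ?w" for x
  proof -
    have "closed_segment w ?w \<subseteq> {x. a \<bullet> x \<ge> m} \<inter> cball 0 M"
      using w ao by (intro closed_segment_subset convex_Int convex_halfspace_ge convex_cball)
        (simp_all add: m_def M_def)
    then show "a \<bullet> x \<ge> m" "norm x \<le> M" using that by auto
  qed
  \<comment> \<open>With this bound the error of linearisation, at most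
    \<open>\<eta> * (t * M)\<close>, is half the least size
    \<open>\<bar>\<gamma>\<bar> * (t * m)\<close> of the linear term.\<close>
  define \<eta> where "\<eta> = \<bar>\<gamma>\<bar> * m / (2 * M)"
  have \<eta>: "\<eta> > 0" using \<gamma>(1) m M by (simp add: \<eta>_def)
  obtain d where d: "d > 0"
    "\<And>y. norm (y - p) < d \<Longrightarrow> norm (f y - f p - frechet_derivative f (at p) (y - p)) \<le> \<eta> * norm (y - p)"
    using local_defining_function_derivative[OF ldf U(2)] \<eta> unfolding has_derivative_at_alt by blast
  obtain d' where d': "d' > 0" "ball p d' \<subseteq> U" using U open_contains_ball by blast
  define e where "e = min 1 (min d d' / M)"
  have e: "e > 0" using d d' M by (simp add: e_def)
  have "p + t *\<^sub>R w \<in> interior K" if t: "t \<in> {0<..<e}" for t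
  proof (rule ccontr)
    assume out: "p + t *\<^sub>R w \<notin> interior K"
    have "e \<le> 1" "e \<le> min d d' / M" unfolding e_def by (rule min.cobounded1, rule min.cobounded2)
    moreover have te: "0 < t" "t < e" using t by simp_all
    ultimately have "t < 1" "t < min d d' / M" by linarith+
    moreover from this(2) have "t * M < min d d'" using M by (simp only: pos_less_divide_eq)
    ultimately have t': "0 < t" "t < 1" "t * M < d" "t * M < d'" using te by simp_all
    let ?T = "(\<lambda>x. p + t *\<^sub>R x) ` closed_segment w ?w"
    have notS: "y \<notin> frontier K" if y: "y \<in> ?T" for y
    proof
      obtain x where x: "y = p + t *\<^sub>R x" "x \<in> closed_segment w ?w" using y by (rule imageE)
      have "norm (y - p) = t * norm x" using t'(1) by (simp add: x(1))
      then have ny: "norm (y - p) \<le> t * M" using seg(2)[OF x(2)] t'(1) by simp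
      assume "y \<in> frontier K"
      moreover have "y \<in> U" using ny t'(4) by (intro subsetD[OF d'(2)]) (simp add: dist_norm norm_minus_commute)
      ultimately have "f y = 0" using U by blast
      moreover have "norm (y - p) < d" using ny t'(3) by simp
      ultimately have "\<bar>\<gamma> * (a \<bullet> (y - p))\<bar> \<le> \<eta> * norm (y - p)"
        using d(2)[of y] unfolding f0 \<gamma>(2) by simp
      moreover have "\<gamma> * (a \<bullet> (y - p)) = \<gamma> * (t * (a \<bullet> x))" unfolding x(1) by simp
      moreover have "t * (a \<bullet> x) > 0" using seg(1)[OF x(2)] m t'(1) by simp
      ultimately have "\<bar>\<gamma>\<bar> * (t * (a \<bullet> x)) \<le> \<eta> * norm (y - p)"
        by (simp only: abs_mult[of \<gamma>] abs_of_pos)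
      also have "\<dots> \<le> \<eta> * (t * M)" using ny \<eta> by (intro mult_left_mono) auto
      also have "\<dots> = \<bar>\<gamma>\<bar> * (t * m) / 2" using M by (simp add: \<eta>_def)
      also have "\<dots> < \<bar>\<gamma>\<bar> * (t * m)" using \<gamma>(1) t' m by simp
      also have "\<dots> \<le> \<bar>\<gamma>\<bar> * (t * (a \<bullet> x))" using seg(1)[OF x(2)] t' by (intro mult_left_mono) auto
      finally show False by simp
    qed
    have "p - t *\<^sub>R (p - o') \<in> interior K"
      by (rule mem_interior_convex_shrink[OF convex_K o])
        (use subsetD[OF frontier_subset p] t' in simp_all)
    moreover have "p - t *\<^sub>R (p - o') = p + t *\<^sub>R ?w" by (simp add: algebra_simps)
    ultimately have "p + t *\<^sub>R ?w \<in> K" using interior_subset by auto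
    moreover have T: "p + t *\<^sub>R ?w \<in> ?T" "p + t *\<^sub>R w \<in> ?T" by (rule imageI, simp)+
    moreover have "p + t *\<^sub>R w \<notin> K"
    proof
      assume "p + t *\<^sub>R w \<in> K"
      then have "p + t *\<^sub>R w \<in> frontier K" using out closure_subset unfolding frontier_def by blast
      then show False using notS[OF T(2)] by contradiction
    qed
    moreover have "connected ?T"
      by (intro connected_continuous_image continuous_intros connected_segment)
    ultimately have "?T \<inter> frontier K \<noteq> {}"
      using connected_Int_frontier[of ?T K] by blast
    then show False using notS by blast
  qed
  then show ?thesis using e by blast
qed

lemma tangent_space_eq:
  assumes p: "p \<in> frontier K" and a: "norm a = 1" "\<And>x. x \<in> K \<Longrightarrow> a \<bullet> (x - p) \<ge> 0"
  shows "tangent_space (frontier K) p = {v. a \<bullet> v = 0}"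
proof -
  have eq: "frechet_derivative f (at p) v = 0 \<longleftrightarrow> a \<bullet> v = 0"
    if ldf: "local_defining_function (frontier K) p U f" for U f v
  proof -
    obtain \<gamma> where "\<gamma> \<noteq> 0" "\<And>v. frechet_derivative f (at p) v = \<gamma> * (a \<bullet> v)"
      using derivative_proportional_support[OF ldf p a] by blast
    then show ?thesis by simp
  qed
  obtain U f where "local_defining_function (frontier K) p U f" using ex_local_defining_function[OF p] .
  then show ?thesis unfolding tangent_space_def using eq by blast
qed

text \<open>Orthogonality to the tangent space makes a competitor a multiple of \<open>a\<close>;
  unit length leaves \<open>a\<close> and \<open>- a\<close>, and entering the interior selects the
  sign.\<close>

lemma inner_unit_normal_eq:
  assumes p: "p \<in> frontier K" and a: "norm a = 1" "\<And>x. x \<in> K \<Longrightarrow> a \<bullet> (x - p) \<ge> 0"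
  shows "inner_unit_normal K p = a"
  unfolding inner_unit_normal_def
proof (rule the_equality)
  note ts = tangent_space_eq[OF p a]
  have aa: "a \<bullet> a = 1" using a by (simp add: norm_eq_1)
  then show "norm a = 1 \<and> (\<forall>v\<in>tangent_space (frontier K) p. a \<bullet> v = 0) \<and> (\<exists>e>0. \<forall>t\<in>{0<..<e}. p + t *\<^sub>R a \<in> interior K)"
    using support_entering[OF p a, of a] a by (simp add: ts)
  fix m assume m: "norm m = 1 \<and> (\<forall>v\<in>tangent_space (frontier K) p. m \<bullet> v = 0) \<and> (\<exists>e>0. \<forall>t\<in>{0<..<e}. p + t *\<^sub>R m \<in> interior K)"
  let ?z = "m - (a \<bullet> m) *\<^sub>R a"
  have az: "a \<bullet> ?z = 0" using aa by (simp add: inner_diff_right)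
  then have "m \<bullet> ?z = 0" using m ts by blast
  then have "?z \<bullet> ?z = 0" using az by (simp add: inner_diff_left)
  then have ma: "m = (a \<bullet> m) *\<^sub>R a" by simp
  obtain e where e: "e > 0" "\<forall>t\<in>{0<..<e}. p + t *\<^sub>R m \<in> interior K" using m by blast
  then have "p + (e / 2) *\<^sub>R m \<in> interior K" by simp
  then have "p + (e / 2) *\<^sub>R m \<in> K" using interior_subset by (rule subsetD[rotated])
  from a(2)[OF this] have "a \<bullet> m \<ge> 0" using e(1) by (simp add: zero_le_mult_iff)
  moreover have "\<bar>a \<bullet> m\<bar> = 1" using ma m a by (metis norm_scaleR mult.right_neutral)
  ultimately show "m = a" using ma by simp
qed

section \<open>Regularity of the normal field\<close>

abbreviation (input) \<nu> where "\<nu> \<equiv> inner_unit_normal K"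

lemma normal:
  assumes "p \<in> frontier K"
  shows "norm (\<nu> p) = 1" "\<And>x. x \<in> K \<Longrightarrow> \<nu> p \<bullet> (x - p) \<ge> 0"
    "tangent_space (frontier K) p = {v. \<nu> p \<bullet> v = 0}"
proof -
  obtain a where a: "norm a = 1" "\<And>x. x \<in> K \<Longrightarrow> a \<bullet> (x - p) \<ge> 0" using ex_support[OF assms] by blast
  have "\<nu> p = a" by (rule inner_unit_normal_eq[OF assms a])
  then show "norm (\<nu> p) = 1" "\<And>x. x \<in> K \<Longrightarrow> \<nu> p \<bullet> (x - p) \<ge> 0"
    "tangent_space (frontier K) p = {v. \<nu> p \<bullet> v = 0}"
    using a tangent_space_eq[OF assms a] by auto
qed

definition gradient :: "('a \<Rightarrow> real) \<Rightarrow> 'a \<Rightarrow> 'a" where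
  "gradient f x = (\<Sum>b\<in>Basis. frechet_derivative f (at x) b *\<^sub>R b)"

lemma gradient_inner:
  assumes "local_defining_function (frontier K) p U f" "x \<in> U"
  shows "gradient f x \<bullet> v = frechet_derivative f (at x) v"
proof -
  have lin: "linear (frechet_derivative f (at x))"
    using local_defining_function_derivative[OF assms] has_derivative_linear by blast
  have "frechet_derivative f (at x) v = frechet_derivative f (at x) (\<Sum>b\<in>Basis. (v \<bullet> b) *\<^sub>R b)"
    by (simp add: euclidean_representation)
  also have "\<dots> = (\<Sum>b\<in>Basis. (v \<bullet> b) * frechet_derivative f (at x) b)"
    by (simp add: linear_sum[OF lin] linear_scale[OF lin])
  finally have "frechet_derivative f (at x) v = (\<Sum>b\<in>Basis. (v \<bullet> b) * frechet_derivative f (at x) b)" .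
  moreover have "gradient f x \<bullet> v = (\<Sum>b\<in>Basis. (v \<bullet> b) * frechet_derivative f (at x) b)"
    unfolding gradient_def inner_sum_left by (rule sum.cong) (simp_all add: inner_commute)
  ultimately show ?thesis by simp
qed

lemma gradient_normal:
  assumes "local_defining_function (frontier K) p U f" "x \<in> U" "x \<in> frontier K"
  shows "gradient f x = (gradient f x \<bullet> \<nu> x) *\<^sub>R \<nu> x" "gradient f x \<bullet> \<nu> x \<noteq> 0"
proof -
  have ldf: "local_defining_function (frontier K) x U f"
    by (rule local_defining_function_moved[OF assms(1,2)])
  obtain \<gamma> where \<gamma>: "\<gamma> \<noteq> 0" "\<And>v. frechet_derivative f (at x) v = \<gamma> * (\<nu> x \<bullet> v)"
    using derivative_proportional_support[OF ldf assms(3) normal(1,2)[OF assms(3)]] by blast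
  have eq: "gradient f x = \<gamma> *\<^sub>R \<nu> x"
    using gradient_inner[OF assms(1,2)] \<gamma>(2) by (intro vector_eq_ldot[THEN iffD1]) (simp add: inner_commute)
  have "\<nu> x \<bullet> \<nu> x = 1" using normal(1)[OF assms(3)] by (simp add: norm_eq_1)
  then show "gradient f x = (gradient f x \<bullet> \<nu> x) *\<^sub>R \<nu> x" "gradient f x \<bullet> \<nu> x \<noteq> 0"
    unfolding eq using \<gamma>(1) by auto
qed

lemma smooth_derivative_differentiable:
  assumes "local_defining_function (frontier K) p U f" "x \<in> U"
  shows "((\<lambda>y. frechet_derivative f (at y) v) has_derivative
     frechet_derivative (\<lambda>y. frechet_derivative f (at y) v) (at x)) (at x)"
proof -
  have "smooth_on f U" using assms unfolding local_defining_function_def by blast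
  then have "Ck_on (Suc (Suc 0)) f U" unfolding smooth_on_def by blast
  then have "Ck_on (Suc 0) (\<lambda>y. frechet_derivative f (at y) v) U" by simp
  from Ck_on_has_derivative[OF this assms(2)] show ?thesis .
qed

lemma gradient_differentiable:
  assumes "local_defining_function (frontier K) p U f" "x \<in> U"
  shows "gradient f differentiable (at x)"
  unfolding gradient_def
proof (intro differentiable_sum finite_Basis ballI)
  fix b :: 'a
  show "(\<lambda>y. frechet_derivative f (at y) b *\<^sub>R b) differentiable (at x)"
    using has_derivative_scaleR_left[OF smooth_derivative_differentiable[OF assms]]
    unfolding differentiable_def by blast
qed

lemma normal_has_derivative:
  assumes p: "p \<in> frontier K"
  shows "(\<nu> has_derivative frechet_derivative \<nu> (at p within frontier K)) (at p within frontier K)"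
proof -
  obtain o' where o: "o' \<in> interior K" using interior_K by blast
  obtain U f where ldf: "local_defining_function (frontier K) p U f" using ex_local_defining_function[OF p] .
  then have U: "open U" "p \<in> U" unfolding local_defining_function_def by auto
  let ?N = "gradient f"
  have npos: "\<nu> x \<bullet> (o' - x) > 0" if "x \<in> frontier K" for x
    by (rule support_pos_interior[OF normal(1,2)[OF that] o])
  have Nsgn: "sgn (?N x \<bullet> (o' - x)) = sgn (?N x \<bullet> \<nu> x)" if "x \<in> U" "x \<in> frontier K" for x
    using npos[OF that(2)] gradient_normal(1)[OF ldf that]
    by (metis inner_scaleR_left mult.right_neutral sgn_mult sgn_pos)
  define \<sigma> where "\<sigma> = sgn (?N p \<bullet> (o' - p))"
  have \<sigma>: "\<bar>\<sigma>\<bar> = 1" unfolding \<sigma>_def Nsgn[OF U(2) p]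
    using gradient_normal(2)[OF ldf U(2) p] by (simp add: abs_sgn_eq)
  define g where "g = (\<lambda>x. \<sigma> *\<^sub>R (inverse (norm (?N x)) *\<^sub>R ?N x))"
  have Nd: "?N differentiable (at p)" by (rule gradient_differentiable[OF ldf U(2)])
  have Np: "?N p \<noteq> 0" using gradient_normal(2)[OF ldf U(2) p] by auto
  have "(\<lambda>x. norm (?N x)) differentiable (at p)"
    using differentiable_compose[OF differentiable_norm_at[OF Np] Nd] by simp
  then have gd: "g differentiable (at p)"
    unfolding g_def using Nd Np
    by (intro differentiable_scaleR differentiable_const differentiable_inverse) auto
  have cont: "isCont (\<lambda>x. \<sigma> * (?N x \<bullet> (o' - x))) p"
    using differentiable_imp_continuous_within[OF Nd] by (intro continuous_intros) auto
  have "\<sigma> * (?N p \<bullet> (o' - p)) > 0"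
    using \<sigma> unfolding \<sigma>_def by (auto simp: sgn_if split: if_splits)
  then have "\<forall>\<^sub>F x in at p. \<sigma> * (?N x \<bullet> (o' - x)) > 0"
    using order_tendstoD(1)[OF cont[unfolded isCont_def]] by blast
  moreover have "\<forall>\<^sub>F x in at p. x \<in> U" by (rule eventually_at_in_open'[OF U])
  ultimately have ev: "\<forall>\<^sub>F x in at p. \<sigma> * (?N x \<bullet> (o' - x)) > 0 \<and> x \<in> U"
    by (rule eventually_conj)
  have eqn: "\<nu> x = g x" if "\<sigma> * (?N x \<bullet> (o' - x)) > 0" "x \<in> U" "x \<in> frontier K" for x
  proof -
    have \<sigma>': "\<sigma> = sgn (?N x \<bullet> \<nu> x)"
      using that(1) \<sigma> unfolding Nsgn[OF that(2,3), symmetric]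
      by (auto simp: sgn_if zero_less_mult_iff abs_if split: if_splits)
    have "norm (?N x) = \<bar>?N x \<bullet> \<nu> x\<bar>"
      using arg_cong[OF gradient_normal(1)[OF ldf that(2,3)], of norm] normal(1)[OF that(3)] by simp
    then have "g x = (\<sigma> * inverse \<bar>?N x \<bullet> \<nu> x\<bar>) *\<^sub>R ((?N x \<bullet> \<nu> x) *\<^sub>R \<nu> x)"
      unfolding g_def using gradient_normal(1)[OF ldf that(2,3)] by simp
    also have "\<dots> = \<nu> x"
      using gradient_normal(2)[OF ldf that(2,3)] by (simp add: \<sigma>' sgn_if)
    finally show ?thesis by simp
  qed
  have "\<forall>\<^sub>F x in at p within frontier K. g x = \<nu> x"
    using ev unfolding eventually_at_filter by eventually_elim (simp add: eqn)
  moreover have "g p = \<nu> p"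
    using \<open>\<sigma> * (?N p \<bullet> (o' - p)) > 0\<close> U(2) p by (simp add: eqn)
  moreover obtain g' where "(g has_derivative g') (at p within frontier K)"
    using gd has_derivative_at_withinI unfolding differentiable_def by blast
  ultimately have "\<nu> differentiable (at p within frontier K)"
    using has_derivative_transform_eventually p unfolding differentiable_def by blast
  then show ?thesis by (rule frechet_derivative_works[THEN iffD1])
qed

lemma normal_convex_body: "convex_body_normal K \<nu> (\<lambda>p. frechet_derivative \<nu> (at p within frontier K))"
proof
  show "\<exists>t>0. p + t *\<^sub>R w \<in> interior K" if p: "p \<in> frontier K" and w: "\<nu> p \<bullet> w > 0" for p w
  proof -
    obtain e where "e > 0" "\<forall>t\<in>{0<..<e}. p + t *\<^sub>R w \<in> interior K"
      using support_entering[OF p normal(1,2)[OF p] w] by blast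
    then show ?thesis by (intro exI[of _ "e / 2"]) auto
  qed
qed (use compact_K convex_K interior_K normal normal_has_derivative in auto)

end

sublocale smooth_convex_body \<subseteq> convex_body_normal K "inner_unit_normal K"
  "\<lambda>p. frechet_derivative (inner_unit_normal K) (at p within frontier K)"
  by (rule normal_convex_body)

context smooth_convex_body begin

text \<open>Along the boundary the gradient of a local equation is a multiple of the normal, so up to a
  nonzero factor the derivative of the normal is the Hessian.\<close>

lemma normal_derivative_symmetric:
  assumes p: "p \<in> frontier K" and ab: "\<nu> p \<bullet> a = 0" "\<nu> p \<bullet> b = 0"
  defines "D \<equiv> frechet_derivative \<nu> (at p within frontier K)"
  shows "D a \<bullet> b = a \<bullet> D b"
proof -
  obtain U f where ldf: "local_defining_function (frontier K) p U f" using ex_local_defining_function[OF p] .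
  then have U: "open U" "p \<in> U" and "smooth_on f U" unfolding local_defining_function_def by auto
  then have C2: "Ck_on 2 f U" unfolding smooth_on_def by blast
  let ?H = "\<lambda>b. frechet_derivative (\<lambda>y. frechet_derivative f (at y) b) (at p)"
  let ?\<gamma> = "gradient f p \<bullet> \<nu> p"
  have key: "?H b a = ?\<gamma> * (D a \<bullet> b)" if ab: "\<nu> p \<bullet> a = 0" "\<nu> p \<bullet> b = 0" for a b
  proof -
    obtain P where P: "\<And>t::real. P t \<in> frontier K" "P 0 = p" "(P has_vector_derivative a) (at 0)"
      using curve_with_velocity[OF p ab(1)] by blast
    have n': "((\<lambda>t. \<nu> (P t)) has_vector_derivative D a) (at 0)"
      using n_along[OF P(1,3)] unfolding P(2) D_def .
    obtain G where G: "(gradient f has_derivative G) (at (P 0) within range P)"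
      using gradient_differentiable[OF ldf U(2)] has_derivative_at_withinI P(2) unfolding differentiable_def by metis
    have N': "((\<lambda>t. gradient f (P t)) has_vector_derivative G a) (at 0)"
      using vector_derivative_diff_chain_within[of P a 0 UNIV "gradient f" G] P(3) G by (simp add: o_def)
    have \<gamma>': "((\<lambda>t. gradient f (P t) \<bullet> \<nu> (P t)) has_real_derivative gradient f p \<bullet> D a + G a \<bullet> \<nu> p) (at 0)"
      using has_real_derivative_inner[OF N' n'] P(2) by simp
    have nb: "((\<lambda>t. \<nu> (P t) \<bullet> b) has_real_derivative D a \<bullet> b) (at 0)"
      using has_real_derivative_inner[OF n' has_vector_derivative_const[of b]] by simp
    \<comment> \<open>As \<open>\<nu> p \<bullet> b = 0\<close>, the product rule leaves only the
      term with the derivative of the normal.\<close>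
    have 1: "((\<lambda>t. (gradient f (P t) \<bullet> \<nu> (P t)) * (\<nu> (P t) \<bullet> b)) has_real_derivative ?\<gamma> * (D a \<bullet> b)) (at 0)"
      using DERIV_mult[OF \<gamma>' nb] P(2) ab(2) by (simp add: mult_ac)
    have "((\<lambda>y. frechet_derivative f (at y) b) has_derivative ?H b) (at (P 0) within range P)"
      using smooth_derivative_differentiable[OF ldf U(2)] has_derivative_at_withinI P(2) by metis
    then have 2: "((\<lambda>t. frechet_derivative f (at (P t)) b) has_vector_derivative ?H b a) (at 0)"
      using vector_derivative_diff_chain_within[of P a 0 UNIV "\<lambda>y. frechet_derivative f (at y) b" "?H b"] P(3)
      by (simp add: o_def)
    have "isCont P 0" using P(3) has_vector_derivative_continuous by blast
    then have "(P \<longlongrightarrow> P 0) (nhds 0)" unfolding isCont_def tendsto_at_iff_tendsto_nhds .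
    then have "\<forall>\<^sub>F t in nhds 0. P t \<in> U" using U unfolding P(2) by (rule topological_tendstoD)
    then have ev: "\<forall>\<^sub>F t in nhds 0. frechet_derivative f (at (P t)) b = (gradient f (P t) \<bullet> \<nu> (P t)) * (\<nu> (P t) \<bullet> b)"
    proof eventually_elim
      case (elim t)
      have "frechet_derivative f (at (P t)) b = gradient f (P t) \<bullet> b"
        using gradient_inner[OF ldf elim] by simp
      also have "\<dots> = (gradient f (P t) \<bullet> \<nu> (P t)) * (\<nu> (P t) \<bullet> b)"
        by (subst gradient_normal(1)[OF ldf elim P(1)]) simp
      finally show ?case .
    qed
    have "((\<lambda>t. frechet_derivative f (at (P t)) b) has_real_derivative ?\<gamma> * (D a \<bullet> b)) (at 0)"
      using 1 DERIV_cong_ev[OF refl ev refl] by simp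
    then show ?thesis using 2 DERIV_unique by (simp add: has_real_derivative_iff_has_vector_derivative[symmetric])
  qed
  have "?\<gamma> * (D a \<bullet> b) = ?\<gamma> * (D b \<bullet> a)"
    using key[OF ab] key[OF ab(2,1)] frechet_second_derivative_symmetric[OF C2 U] by metis
  then show ?thesis using gradient_normal(2)[OF ldf U(2) p] by (simp add: inner_commute)
qed

end

section \<open>Angles with hyperplanes and the conclusion\<close>

lemma infdist_hyperplane:
  fixes m v :: "'a::euclidean_space"
  assumes "norm m = 1" shows "infdist v {x. m \<bullet> x = 0} = \<bar>m \<bullet> v\<bar>"
proof (rule antisym)
  have mm: "m \<bullet> m = 1" using assms by (simp add: norm_eq_1)
  have "infdist v {x. m \<bullet> x = 0} \<le> dist v (v - (m \<bullet> v) *\<^sub>R m)"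
    by (rule infdist_le) (simp add: inner_diff_right mm)
  then show "infdist v {x. m \<bullet> x = 0} \<le> \<bar>m \<bullet> v\<bar>" using assms by (simp add: dist_norm)
  have ne: "{x. m \<bullet> x = 0} \<noteq> {}" by (auto intro: exI[of _ 0])
  show "\<bar>m \<bullet> v\<bar> \<le> infdist v {x. m \<bullet> x = 0}"
    unfolding infdist_notempty[OF ne]
  proof (rule cINF_greatest[OF ne])
    fix x assume "x \<in> {x. m \<bullet> x = 0}"
    then have "m \<bullet> v = m \<bullet> (v - x)" by (simp add: inner_diff_right)
    then show "\<bar>m \<bullet> v\<bar> \<le> dist v x"
      using Cauchy_Schwarz_ineq2[of m "v - x"] assms by (simp add: dist_norm)
  qed
qed

lemma hyperplane_angle_eq_iff:
  fixes m v :: "'a::euclidean_space"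
  assumes "norm m = 1" "v \<noteq> 0" "0 < \<delta>" "\<delta> < pi / 2"
  shows "hyperplane_angle v {x. m \<bullet> x = 0} = \<delta> \<longleftrightarrow> \<bar>m \<bullet> v\<bar> = sin \<delta> * norm v"
proof -
  let ?r = "\<bar>m \<bullet> v\<bar> / norm v"
  have r: "0 \<le> ?r" "?r \<le> 1" using Cauchy_Schwarz_ineq2[of m v] assms by (auto simp: divide_simps)
  have "sin (arcsin ?r) = ?r" by (rule sin_arcsin) (use r in linarith)+
  moreover have "arcsin (sin \<delta>) = \<delta>" by (rule arcsin_sin) (use assms in linarith)+
  ultimately have "arcsin ?r = \<delta> \<longleftrightarrow> ?r = sin \<delta>" by metis
  then show ?thesis using assms(2) by (simp add: hyperplane_angle_def infdist_hyperplane[OF assms(1)] divide_eq_eq)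
qed

theorem theorem1p1:
  fixes K S :: "'a::euclidean_space set" and \<delta> :: real
  assumes "DIM('a) \<ge> 3"
    and "compact K" and "convex K" and "interior K \<noteq> {}"
    and "S = frontier K"
    and "smooth_hypersurface S"
    and "\<And>p \<kappa>. p \<in> S \<Longrightarrow> principal_curvature K p \<kappa> \<Longrightarrow> \<kappa> > 0"
    and "0 < \<delta>" and "\<delta> < pi / 2"
    and "\<And>p q. p \<in> S \<Longrightarrow> q \<in> S \<Longrightarrow> p \<noteq> q \<Longrightarrow>
           hyperplane_angle (q - p) (tangent_space S p) = \<delta> \<Longrightarrow>
           hyperplane_angle (q - p) (tangent_space S q) = \<delta>"
  shows "\<exists>c r. r > 0 \<and> S = sphere c r"
proof -
  interpret smooth_convex_body K
    using assms(2-6) by unfold_locales auto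
  let ?n = "inner_unit_normal K"
  let ?D = "\<lambda>p. frechet_derivative ?n (at p within frontier K)"
  interpret equal_angle_body K ?n ?D \<delta>
  proof
    show "DIM('a) \<ge> 3" "0 < \<delta>" "\<delta> < pi / 2" by fact+
    show "?D p a \<bullet> b = a \<bullet> ?D p b"
      if "p \<in> frontier K" "?n p \<bullet> a = 0" "?n p \<bullet> b = 0" for p a b
      by (rule normal_derivative_symmetric[OF that])
    show "a = 0" if p: "p \<in> frontier K" and a: "?n p \<bullet> a = 0" "?D p a = 0" for p a
    proof (rule ccontr)
      assume "a \<noteq> 0"
      \<comment> \<open>A kernel vector would be a principal direction of curvature 0, contrary to
        positivity.\<close>
      then have "principal_curvature K p 0"
        using a normal(3)[OF p] unfolding principal_curvature_def shape_operator_def by auto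
      then show False using assms(7)[of p 0] p assms(5) by simp
    qed
    show "?n q \<bullet> (q - p) = - sin \<delta> * norm (q - p)"
      if p: "p \<in> frontier K" and q: "q \<in> frontier K" and ne: "p \<noteq> q"
        and eq: "?n p \<bullet> (q - p) = sin \<delta> * norm (q - p)" for p q
    proof -
      have iff: "hyperplane_angle (q - p) (tangent_space S x) = \<delta> \<longleftrightarrow>
          \<bar>?n x \<bullet> (q - p)\<bar> = sin \<delta> * norm (q - p)" if x: "x \<in> frontier K" for x
        using hyperplane_angle_eq_iff[OF normal(1)[OF x] _ assms(8,9), of "q - p"] ne
        unfolding assms(5) normal(3)[OF x] by simp
      have "sin \<delta> \<ge> 0" using assms(8,9) by (intro sin_ge_zero) auto
      then have "\<bar>?n p \<bullet> (q - p)\<bar> = sin \<delta> * norm (q - p)" unfolding eq by simp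
      then have "\<bar>?n q \<bullet> (q - p)\<bar> = sin \<delta> * norm (q - p)"
        using assms(10)[of p q] p q ne iff assms(5) by simp
      \<comment> \<open>The unsigned angle fixes only the absolute value; support at
        \<open>q\<close> gives the sign.\<close>
      moreover have "?n q \<bullet> (p - q) \<ge> 0"
        using normal(2)[OF q] subsetD[OF frontier_subset p] by simp
      ultimately show ?thesis by (simp add: inner_diff_right)
    qed
  qed
  show ?thesis using frontier_eq_sphere assms(5) by simp
qed

end
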